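(* The category $\mathsf{KRLPries}$ of KRL-spaces and L-morphisms is equivalent to the category $\mathsf{KHaus}$ of compact Hausdorff spaces and continuous maps.
   Context: For a poset, $\mathord\uparrow S$ and $\mathord\downarrow S$ denote the up-closure and down-closure of a subset $S$; $\mathord\downarrow x=\mathord\downarrow\{x\}$; $S$ is an upset if $S=\mathord\uparrow S$; $\min(S)$ is the set of minimal elements of $S$. $\mathrm{cl}$ is topological closure. A Priestley space is a compact topological space $X$ with a partial order $\le$ such that whenever $x\not\le y$ there is a clopen upset $U$ with $x\in U$, $y\notin U$. $\mathrm{ClopUp}(X)$ is the set of clopen upsets of $X$. An Esakia space is a Priestley space in which $\mathord\downarrow U$ is clopen for every clopen $U$. An L-space is an Esakia space in which $\mathrm{cl}\,U$ is open for every open upset $U$. An L-morphism $f:X_1\to X_2$ between L-spaces is a continuous order-preserving map such that $f^{-1}(\mathrm{cl}\,U)=\mathrm{cl}\,f^{-1}(U)$ for every open upset $U$ of $X_2$. Let $X$ be an L-space. The localic part of $X$ is $Y=\{y\in X\mid\mathord\downarrow y\text{ is clopen}\}$. A Scott upset of $X$ is a closed upset $F$ with $\min(F)\subseteq Y$. $X$ is L-compact if $X$ itself is a Scott upset (i.e. $\min(X)\subseteq Y$). For $U,V\in\mathrm{ClopUp}(X)$, $V\prec U$ means $\mathord\downarrow V\subseteq U$, and the regular part of $U$ is $\mathrm{reg}\,U=\bigcup\{V\in\mathrm{ClopUp}(X)\mid V\prec U\}$. $X$ is L-regular if $\mathrm{reg}\,U$ is dense in $U$ for every $U\in\mathrm{ClopUp}(X)$.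 A KRL-space is an L-space that is L-compact and L-regular. $\mathsf{KRLPries}$ is the category of KRL-spaces and all L-morphisms between them. *)

theory Defs
  imports "HOL-Analysis.Analysis"
begin

section \<open>Categories\<close>

text \<open>Arrows carry no domain or codomain, so identities, composition and the arrow part of a
  functor take the objects involved as arguments: \<open>Comp C x y z g f\<close> is
  the composite of \<open>f : x \<rightarrow> y\<close> and \<open>g : y \<rightarrow> z\<close>.\<close>

record ('o, 'm) category =
  Ob :: "'o set"
  Hom :: "'o \<Rightarrow> 'o \<Rightarrow> 'm set"
  Idt :: "'o \<Rightarrow> 'm"
  Comp :: "'o \<Rightarrow> 'o \<Rightarrow> 'o \<Rightarrow> 'm \<Rightarrow> 'm \<Rightarrow> 'm"

definition is_category :: "('o, 'm) category \<Rightarrow> bool" where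
  "is_category C \<longleftrightarrow>
     (\<forall>x\<in>Ob C. Idt C x \<in> Hom C x x) \<and>
     (\<forall>x\<in>Ob C. \<forall>y\<in>Ob C. \<forall>z\<in>Ob C. \<forall>f\<in>Hom C x y. \<forall>g\<in>Hom C y z.
        Comp C x y z g f \<in> Hom C x z) \<and>
     (\<forall>x\<in>Ob C. \<forall>y\<in>Ob C. \<forall>f\<in>Hom C x y.
        Comp C x x y f (Idt C x) = f \<and> Comp C x y y (Idt C y) f = f) \<and>
     (\<forall>w\<in>Ob C. \<forall>x\<in>Ob C. \<forall>y\<in>Ob C. \<forall>z\<in>Ob C.
        \<forall>f\<in>Hom C w x. \<forall>g\<in>Hom C x y. \<forall>h\<in>Hom C y z.
        Comp C w y z h (Comp C w x y g f) = Comp C w x z (Comp C x y z h g) f)"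

definition is_functor ::
    "('o, 'm) category \<Rightarrow> ('p, 'n) category \<Rightarrow> ('o \<Rightarrow> 'p) \<Rightarrow> ('o \<Rightarrow> 'o \<Rightarrow> 'm \<Rightarrow> 'n) \<Rightarrow> bool" where
  "is_functor C D Fo Fa \<longleftrightarrow>
     (\<forall>x\<in>Ob C. Fo x \<in> Ob D) \<and>
     (\<forall>x\<in>Ob C. \<forall>y\<in>Ob C. \<forall>f\<in>Hom C x y. Fa x y f \<in> Hom D (Fo x) (Fo y)) \<and>
     (\<forall>x\<in>Ob C. Fa x x (Idt C x) = Idt D (Fo x)) \<and>
     (\<forall>x\<in>Ob C. \<forall>y\<in>Ob C. \<forall>z\<in>Ob C. \<forall>f\<in>Hom C x y. \<forall>g\<in>Hom C y z.
        Fa x z (Comp C x y z g f) = Comp D (Fo x) (Fo y) (Fo z) (Fa y z g) (Fa x y f))"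

definition is_iso :: "('o, 'm) category \<Rightarrow> 'o \<Rightarrow> 'o \<Rightarrow> 'm \<Rightarrow> bool" where
  "is_iso C x y f \<longleftrightarrow> f \<in> Hom C x y \<and>
     (\<exists>g\<in>Hom C y x. Comp C x y x g f = Idt C x \<and> Comp C y x y f g = Idt C y)"

definition natural_iso ::
    "('o, 'm) category \<Rightarrow> ('p, 'n) category \<Rightarrow>
     ('o \<Rightarrow> 'p) \<Rightarrow> ('o \<Rightarrow> 'o \<Rightarrow> 'm \<Rightarrow> 'n) \<Rightarrow> ('o \<Rightarrow> 'p) \<Rightarrow> ('o \<Rightarrow> 'o \<Rightarrow> 'm \<Rightarrow> 'n) \<Rightarrow>
     ('o \<Rightarrow> 'n) \<Rightarrow> bool" where
  "natural_iso C D Fo Fa Go Ga \<eta> \<longleftrightarrow>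
     (\<forall>x\<in>Ob C. is_iso D (Fo x) (Go x) (\<eta> x)) \<and>
     (\<forall>x\<in>Ob C. \<forall>y\<in>Ob C. \<forall>f\<in>Hom C x y.
        Comp D (Fo x) (Fo y) (Go y) (\<eta> y) (Fa x y f) =
        Comp D (Fo x) (Go x) (Go y) (Ga x y f) (\<eta> x))"

definition equivalent_categories :: "('o, 'm) category \<Rightarrow> ('p, 'n) category \<Rightarrow> bool" where
  "equivalent_categories C D \<longleftrightarrow> is_category C \<and> is_category D \<and>
     (\<exists>Fo Fa Go Ga \<eta> \<epsilon>.
        is_functor C D Fo Fa \<and> is_functor D C Go Ga \<and>
        natural_iso C C (\<lambda>x. x) (\<lambda>x y f. f)
          (\<lambda>x. Go (Fo x)) (\<lambda>x y f. Ga (Fo x) (Fo y) (Fa x y f)) \<eta> \<and>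
        natural_iso D D (\<lambda>x. Fo (Go x)) (\<lambda>x y f. Fa (Go x) (Go y) (Ga x y f))
          (\<lambda>x. x) (\<lambda>x y f. f) \<epsilon>)"


section \<open>Ordered topological spaces\<close>

text \<open>A pair \<open>(x, y)\<close> in \<open>ord X\<close> means \<open>x \<le> y\<close>.\<close>

record 'a ord_space =
  topo :: "'a topology"
  ord :: "'a rel"

abbreviation points :: "'a ord_space \<Rightarrow> 'a set" where
  "points X \<equiv> topspace (topo X)"

definition up :: "'a ord_space \<Rightarrow> 'a set \<Rightarrow> 'a set" where
  "up X S = {y \<in> points X. \<exists>x\<in>S. (x, y) \<in> ord X}"

definition down :: "'a ord_space \<Rightarrow> 'a set \<Rightarrow> 'a set" where
  "down X S = {x \<in> points X. \<exists>y\<in>S. (x, y) \<in> ord X}"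

definition upset :: "'a ord_space \<Rightarrow> 'a set \<Rightarrow> bool" where
  "upset X S \<longleftrightarrow> S = up X S"

definition min_elems :: "'a ord_space \<Rightarrow> 'a set \<Rightarrow> 'a set" where
  "min_elems X S = {m \<in> S. \<forall>s\<in>S. (s, m) \<in> ord X \<longrightarrow> s = m}"

definition clopen :: "'a ord_space \<Rightarrow> 'a set \<Rightarrow> bool" where
  "clopen X U \<longleftrightarrow> openin (topo X) U \<and> closedin (topo X) U"

definition ClopUp :: "'a ord_space \<Rightarrow> 'a set set" where
  "ClopUp X = {U. clopen X U \<and> upset X U}"

definition Priestley_space :: "'a ord_space \<Rightarrow> bool" where
  "Priestley_space X \<longleftrightarrow>
     partial_order_on (points X) (ord X) \<and> compact_space (topo X) \<and>
     (\<forall>x\<in>points X. \<forall>y\<in>points X. (x, y) \<notin> ord X \<longrightarrow> (\<exists>U\<in>ClopUp X. x \<in> U \<and> y \<notin> U))"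

definition Esakia_space :: "'a ord_space \<Rightarrow> bool" where
  "Esakia_space X \<longleftrightarrow> Priestley_space X \<and> (\<forall>U. clopen X U \<longrightarrow> clopen X (down X U))"

definition L_space :: "'a ord_space \<Rightarrow> bool" where
  "L_space X \<longleftrightarrow> Esakia_space X \<and>
     (\<forall>U. openin (topo X) U \<and> upset X U \<longrightarrow> openin (topo X) (topo X closure_of U))"

definition L_morphism :: "'a ord_space \<Rightarrow> 'b ord_space \<Rightarrow> ('a \<Rightarrow> 'b) \<Rightarrow> bool" where
  "L_morphism X1 X2 f \<longleftrightarrow>
     continuous_map (topo X1) (topo X2) f \<and>
     (\<forall>x y. (x, y) \<in> ord X1 \<longrightarrow> (f x, f y) \<in> ord X2) \<and>
     (\<forall>U. openin (topo X2) U \<and> upset X2 U \<longrightarrow>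
        {x \<in> points X1. f x \<in> topo X2 closure_of U} =
        topo X1 closure_of {x \<in> points X1. f x \<in> U})"

definition localic_part :: "'a ord_space \<Rightarrow> 'a set" where
  "localic_part X = {y \<in> points X. clopen X (down X {y})}"

definition Scott_upset :: "'a ord_space \<Rightarrow> 'a set \<Rightarrow> bool" where
  "Scott_upset X F \<longleftrightarrow>
     closedin (topo X) F \<and> upset X F \<and> min_elems X F \<subseteq> localic_part X"

definition L_compact :: "'a ord_space \<Rightarrow> bool" where
  "L_compact X \<longleftrightarrow> Scott_upset X (points X)"

definition well_inside :: "'a ord_space \<Rightarrow> 'a set \<Rightarrow> 'a set \<Rightarrow> bool" where
  "well_inside X V U \<longleftrightarrow> down X V \<subseteq> U"

definition reg :: "'a ord_space \<Rightarrow> 'a set \<Rightarrow> 'a set" where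
  "reg X U = \<Union>{V \<in> ClopUp X. well_inside X V U}"

definition L_regular :: "'a ord_space \<Rightarrow> bool" where
  "L_regular X \<longleftrightarrow> (\<forall>U\<in>ClopUp X. U \<subseteq> topo X closure_of reg X U)"

definition KRL_space :: "'a ord_space \<Rightarrow> bool" where
  "KRL_space X \<longleftrightarrow> L_space X \<and> L_compact X \<and> L_regular X"


section \<open>The two categories\<close>

text \<open>Maps are taken extensional (i.e. \<open>undefined\<close> outside the domain), so that equality of arrows
  is equality of maps on the domain. The points of a space lie in a fixed type; the predicate
  \<open>P\<close> selects, by size, the objects of a full subcategory of the category of all spaces over
  that type.\<close>

definition KRLPries :: "('a ord_space \<Rightarrow> bool) \<Rightarrow> ('a ord_space, 'a \<Rightarrow> 'a) category" where
  "KRLPries P =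
     \<lparr>Ob = {X. KRL_space X \<and> P X},
      Hom = (\<lambda>X1 X2. {f \<in> extensional (points X1). L_morphism X1 X2 f}),
      Idt = (\<lambda>X. restrict (\<lambda>x. x) (points X)),
      Comp = (\<lambda>X1 X2 X3 g f. compose (points X1) g f)\<rparr>"

definition KHaus :: "('a topology \<Rightarrow> bool) \<Rightarrow> ('a topology, 'a \<Rightarrow> 'a) category" where
  "KHaus P =
     \<lparr>Ob = {Z. compact_space Z \<and> Hausdorff_space Z \<and> P Z},
      Hom = (\<lambda>Z1 Z2. {f \<in> extensional (topspace Z1). continuous_map Z1 Z2 f}),
      Idt = (\<lambda>Z. restrict (\<lambda>z. z) (topspace Z)),
      Comp = (\<lambda>Z1 Z2 Z3 g f. compose (topspace Z1) g f)\<rparr>"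


section \<open>Size\<close>

text \<open>The spaces on subsets of an arbitrary fixed type are not closed under the passage from a
  compact Hausdorff space \<open>Z\<close> to its KRL-space, whose points are the prime filters of the frame of
  opens of \<open>Z\<close>, hence elements of \<open>'a set set\<close> if \<open>Z\<close> lives in \<open>'a\<close>. As in set-theoretic
  foundations, ``all spaces'' is therefore read relative to a universe, a collection of small sets
  closed (up to bijection) under subsets and power sets; no further closure is
  needed. Examples are the finite subsets of \<open>nat\<close> and the sets of cardinality below a strong
  limit cardinal. HOL does not prove that a universe with infinite small sets exists, so
  the assumption-free alternative is to bound the number of points of \<open>Z\<close> on the one side and,
  correspondingly, of points in the localic part on the other: see
  \<open>localic_part_within\<close>.\<close>

definition universe :: "('u set \<Rightarrow> bool) \<Rightarrow> bool" where
  "universe small \<longleftrightarrow>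
     (\<forall>A B. small A \<and> B \<lesssim> A \<longrightarrow> small B) \<and>
     (\<forall>A. small A \<longrightarrow> (\<exists>B. small B \<and> Pow A \<lesssim> B))"

text \<open>The localic part of a KRL-space determines it up to isomorphism, so if the localic
  part injects into \<open>'a\<close>, then the space has an isomorphic copy with points in
  \<open>'a set set\<close>. Every KRL-space thus occurs, up to isomorphism, for a suitable \<open>'a\<close>.\<close>

definition localic_part_within :: "'a itself \<Rightarrow> 'b ord_space \<Rightarrow> bool" where
  "localic_part_within _ X \<longleftrightarrow> localic_part X \<lesssim> (UNIV :: 'a set)"

end

theory Submission
  imports Defs
begin

text \<open>The localic part \<open>Y\<close> of a KRL-space \<open>X\<close>, with the traces of the open upsets as its open sets
(\<open>Loc X\<close>), is a compact Hausdorff space that remembers everything about \<open>X\<close>. The equivalence is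
the functor \<open>X \<mapsto> Loc X\<close>; it is shown to be fully faithful and essentially surjective.

The key to full faithfulness is that L-regularity and L-compactness make \<open>Y\<close> the set of minimal
points. If a localic point lies in the closure of an upset, then it lies in the upset, as its
down-set is open. Every point has a localic point below it, and regularity turns this
into \<open>ClopUp_le_if_trace_le\<close>: a clopen upset is determined by its trace on \<open>Y\<close>. Thus
\<open>U \<mapsto> U \<inter> Y\<close> is an isomorphism from the clopen upsets of \<open>X\<close> to the opens of \<open>Loc X\<close>. An
L-morphism maps localic points to localic points and is determined by its values there, as clopen
upsets separate points. Conversely, a continuous map \<open>g\<close> between localic parts pulls clopen upsets
back to clopen upsets by way of traces; this lattice homomorphism is \<open>U \<mapsto> f\<^sup>-\<^sup>1(U)\<close> for a
unique continuous order-preserving \<open>f\<close>, by compactness, and \<open>f\<close> is an L-morphism because closures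
of open upsets are clopen upsets, which again are determined by their traces
(\<open>L_morphism_extension\<close>).

For essential surjectivity, a compact Hausdorff space \<open>Z\<close> is recovered from the space of prime
filters of its opens: its localic points are the neighbourhood filters
(\<open>Loc_spectrum_homeomorphic\<close>). That this space is a KRL-space rests on a single remark, used in many
forms: every nonempty basic open set contains a neighbourhood filter. The prime filter theorem is
not invoked separately, since it follows from compactness of the space of prime filters, which is a
closed subset of a power of the two-point space.

Sizes enter only through the choice of the objects. The functor that is used sends \<open>X\<close> to any chosen
homeomorphic copy of \<open>Loc X\<close> in the type at hand, and the prime filters of \<open>Z\<close> may be represented by
any set in bijection with them. So \<open>KRLPries_equivalent_KHaus\<close> asks only that each of the two
classes of spaces contains enough copies, and this is all that remains to be checked in
the two parts of the theorem.\<close>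

section \<open>Compactness and separation in Priestley and Esakia spaces\<close>

lemma compact_space_directed_Inter:
  assumes "compact_space T" "\<F> \<noteq> {}"
    and "\<And>C. C \<in> \<F> \<Longrightarrow> closedin T C" "\<And>C. C \<in> \<F> \<Longrightarrow> C \<noteq> {}"
    and dir: "\<And>C D. C \<in> \<F> \<Longrightarrow> D \<in> \<F> \<Longrightarrow> \<exists>E\<in>\<F>. E \<subseteq> C \<inter> D"
  shows "\<Inter>\<F> \<noteq> {}"
proof -
  have "\<exists>E\<in>\<F>. E \<subseteq> \<Inter>\<G>" if "finite \<G>" "\<G> \<subseteq> \<F>" for \<G>
    using that
  proof (induction \<G>)
    case empty
    then show ?case using \<open>\<F> \<noteq> {}\<close> by auto
  next
    case (insert C \<G>)
    then obtain E where E: "E \<in> \<F>" "E \<subseteq> \<Inter>\<G>" by auto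
    obtain E' where "E' \<in> \<F>" "E' \<subseteq> C \<inter> E" using dir[of C E] insert.prems E(1) by auto
    then show ?case using E(2) by (metis Inter_insert Int_mono order_refl order_trans)
  qed
  then have "\<forall>\<G>. finite \<G> \<and> \<G> \<subseteq> \<F> \<longrightarrow> \<Inter>\<G> \<noteq> {}"
    using assms(4) by (metis subset_empty)
  then show ?thesis
    using assms(1,3) unfolding compact_space_fip by blast
qed

text \<open>The form of compactness used throughout. With \<open>\<U>\<close> and \<open>\<V>\<close> directed, the closed sets \<open>K \<inter> U - V\<close>
form a filter base with empty intersection, so one of them is empty. Taking for \<open>\<U>\<close> the clopen
upsets containing a point and for \<open>\<V>\<close> those missing it, the hypothesis becomes a pointwise
separation statement and the conclusion a uniform one.\<close>

lemma compact_separation: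
  assumes "compact_space T" "closedin T K" "\<U> \<noteq> {}" "\<V> \<noteq> {}"
    and U: "\<And>U. U \<in> \<U> \<Longrightarrow> closedin T U" "\<And>U U'. U \<in> \<U> \<Longrightarrow> U' \<in> \<U> \<Longrightarrow> U \<inter> U' \<in> \<U>"
    and V: "\<And>V. V \<in> \<V> \<Longrightarrow> openin T V" "\<And>V V'. V \<in> \<V> \<Longrightarrow> V' \<in> \<V> \<Longrightarrow> V \<union> V' \<in> \<V>"
    and cov: "K \<inter> \<Inter>\<U> \<subseteq> \<Union>\<V>"
  obtains U V where "U \<in> \<U>" "V \<in> \<V>" "K \<inter> U \<subseteq> V"
proof -
  define \<F> where "\<F> = {K \<inter> U - V | U V. U \<in> \<U> \<and> V \<in> \<V>}"
  have "\<exists>C\<in>\<F>. C = {}"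
  proof (rule ccontr)
    assume *: "\<not> ?thesis"
    have "\<Inter>\<F> \<noteq> {}"
    proof (rule compact_space_directed_Inter[OF assms(1)])
      show "\<F> \<noteq> {}" using assms(3,4) by (auto simp: \<F>_def)
      show "closedin T C" if "C \<in> \<F>" for C
        using that U(1) V(1) assms(2) unfolding \<F>_def by (auto intro!: closedin_diff closedin_Int)
      show "C \<noteq> {}" if "C \<in> \<F>" for C using * that by blast
      fix C D assume "C \<in> \<F>" "D \<in> \<F>"
      then obtain U V U' V' where "C = K \<inter> U - V" "D = K \<inter> U' - V'"
        "U \<in> \<U>" "U' \<in> \<U>" "V \<in> \<V>" "V' \<in> \<V>" unfolding \<F>_def by blast
      then have "U \<inter> U' \<in> \<U>" "V \<union> V' \<in> \<V>" "K \<inter> (U \<inter> U') - (V \<union> V') \<subseteq> C \<inter> D"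
        using U(2) V(2) by auto
      moreover from this have "K \<inter> (U \<inter> U') - (V \<union> V') \<in> \<F>"
        unfolding \<F>_def by blast
      ultimately show "\<exists>E\<in>\<F>. E \<subseteq> C \<inter> D" by blast
    qed
    then obtain x where "x \<in> \<Inter>\<F>" by blast
    then have x: "x \<in> K \<inter> U - V" if "U \<in> \<U>" "V \<in> \<V>" for U V
      using that unfolding \<F>_def by blast
    then have "x \<in> K \<inter> \<Inter>\<U>" "x \<notin> \<Union>\<V>" using assms(3,4) by blast+
    then show False using cov by blast
  qed
  then show ?thesis using that unfolding \<F>_def by blast
qed

context
  fixes X :: "'a ord_space"
  assumes X: "Priestley_space X"
begin

lemma ord_in_points: "(x, y) \<in> ord X \<Longrightarrow> x \<in> points X \<and> y \<in> points X"
  and ord_refl: "x \<in> points X \<Longrightarrow> (x, x) \<in> ord X"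
  and ord_trans: "(x, y) \<in> ord X \<Longrightarrow> (y, z) \<in> ord X \<Longrightarrow> (x, z) \<in> ord X"
  and ord_antisym: "(x, y) \<in> ord X \<Longrightarrow> (y, x) \<in> ord X \<Longrightarrow> x = y"
  using X unfolding Priestley_space_def partial_order_on_def preorder_on_def
  by (auto simp: refl_on_def antisym_def dest: transD)

lemma Priestley_compact: "compact_space (topo X)"
  using X by (simp add: Priestley_space_def)

lemma Priestley_separation:
  assumes "x \<in> points X" "y \<in> points X" "(x, y) \<notin> ord X"
  obtains U where "U \<in> ClopUp X" "x \<in> U" "y \<notin> U"
  using X assms unfolding Priestley_space_def by blast

lemma upset_iff:
  "upset X S \<longleftrightarrow> S \<subseteq> points X \<and> (\<forall>x y. x \<in> S \<longrightarrow> (x, y) \<in> ord X \<longrightarrow> y \<in> S)"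
  unfolding upset_def up_def using ord_refl ord_in_points by blast

lemma upset_Un: "upset X S \<Longrightarrow> upset X T \<Longrightarrow> upset X (S \<union> T)"
  and upset_Int: "upset X S \<Longrightarrow> upset X T \<Longrightarrow> upset X (S \<inter> T)"
  and upset_Union: "(\<And>S. S \<in> \<S> \<Longrightarrow> upset X S) \<Longrightarrow> upset X (\<Union>\<S>)"
  and upset_empty: "upset X {}"
  and upset_points: "upset X (points X)"
  unfolding upset_iff using ord_in_points by blast+

lemma ClopUp_iff: "U \<in> ClopUp X \<longleftrightarrow> openin (topo X) U \<and> closedin (topo X) U \<and> upset X U"
  by (auto simp: ClopUp_def clopen_def)

lemma ClopUp_Un: "U \<in> ClopUp X \<Longrightarrow> V \<in> ClopUp X \<Longrightarrow> U \<union> V \<in> ClopUp X"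
  and ClopUp_Int: "U \<in> ClopUp X \<Longrightarrow> V \<in> ClopUp X \<Longrightarrow> U \<inter> V \<in> ClopUp X"
  and ClopUp_empty: "{} \<in> ClopUp X"
  and ClopUp_points: "points X \<in> ClopUp X"
  unfolding ClopUp_iff using upset_Un upset_Int upset_empty upset_points by auto

lemma ClopUp_ordD: "U \<in> ClopUp X \<Longrightarrow> x \<in> U \<Longrightarrow> (x, y) \<in> ord X \<Longrightarrow> y \<in> U"
  unfolding ClopUp_iff upset_iff by blast

lemma ClopUp_subset: "U \<in> ClopUp X \<Longrightarrow> U \<subseteq> points X"
  unfolding ClopUp_iff upset_iff by blast

lemma ord_iff_ClopUp:
  assumes "x \<in> points X" "y \<in> points X"
  shows "(x, y) \<in> ord X \<longleftrightarrow> (\<forall>U\<in>ClopUp X. x \<in> U \<longrightarrow> y \<in> U)"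
  using assms Priestley_separation ClopUp_ordD by metis

lemma eq_if_same_ClopUp:
  assumes "x \<in> points X" "y \<in> points X" "\<And>U. U \<in> ClopUp X \<Longrightarrow> x \<in> U \<longleftrightarrow> y \<in> U"
  shows "x = y"
  using assms ord_iff_ClopUp ord_antisym by metis

text \<open>By compactness of the complement of \<open>W\<close>: a point other than \<open>p\<close> misses some clopen upset that contains \<open>p\<close>
or lies in one that does not.\<close>

lemma ClopUp_basis:
  assumes "openin (topo X) W" "p \<in> W"
  obtains U V where "U \<in> ClopUp X" "V \<in> ClopUp X" "p \<in> U - V" "U - V \<subseteq> W"
proof -
  have p: "p \<in> points X" using assms openin_subset by blast
  define \<U> \<V> where "\<U> = {U \<in> ClopUp X. p \<in> U}" and "\<V> = {V \<in> ClopUp X. p \<notin> V}"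
  obtain U V where UV: "U \<in> \<U>" "V \<in> \<V>" "(points X - W) \<inter> U \<subseteq> V"
  proof (rule compact_separation[OF Priestley_compact, of "points X - W" \<U> \<V>])
    show "closedin (topo X) (points X - W)" using assms(1) by auto
    show "\<U> \<noteq> {}" using ClopUp_points p by (auto simp: \<U>_def)
    show "\<V> \<noteq> {}" using ClopUp_empty by (auto simp: \<V>_def)
    show "(points X - W) \<inter> \<Inter> \<U> \<subseteq> \<Union> \<V>"
    proof
      fix q assume q: "q \<in> (points X - W) \<inter> \<Inter> \<U>"
      then have "q \<noteq> p" using assms(2) by blast
      then show "q \<in> \<Union>\<V>"
        using eq_if_same_ClopUp[OF p, of q] q unfolding \<U>_def \<V>_def by blast
    qed
  qed (auto simp: \<U>_def \<V>_def ClopUp_Int ClopUp_Un, auto simp: ClopUp_iff)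
  then show ?thesis
    using that[of U V] ClopUp_subset unfolding \<U>_def \<V>_def by blast
qed

lemma ClopUp_disjoint_closed:
  assumes "closedin (topo X) F" "p \<in> points X" "\<And>y. y \<in> F \<Longrightarrow> (p, y) \<notin> ord X"
  obtains U where "U \<in> ClopUp X" "p \<in> U" "U \<inter> F = {}"
proof -
  define \<U> where "\<U> = {U \<in> ClopUp X. p \<in> U}"
  obtain U V where UV: "U \<in> \<U>" "V \<in> {{}}" "F \<inter> U \<subseteq> (V :: 'a set)"
  proof (rule compact_separation[OF Priestley_compact assms(1), of \<U> "{{}}"])
    show "\<U> \<noteq> {}" using ClopUp_points assms by (auto simp: \<U>_def)
    have "F \<subseteq> points X" using assms(1) closedin_subset by blast
    then have "(p, y) \<in> ord X" if "y \<in> F" "y \<in> \<Inter>\<U>" for y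
      using that assms(2) ord_iff_ClopUp[of p y] unfolding \<U>_def by blast
    then show "F \<inter> \<Inter> \<U> \<subseteq> \<Union> {{}}"
      using assms(3) by blast
  qed (auto simp: \<U>_def ClopUp_Int, auto simp: ClopUp_iff)
  then show ?thesis
    using that[of U] unfolding \<U>_def by blast
qed

lemma closedin_down:
  assumes "closedin (topo X) F"
  shows "closedin (topo X) (down X F)"
proof -
  have "\<exists>T. openin (topo X) T \<and> p \<in> T \<and> T \<subseteq> points X - down X F" if p: "p \<in> points X - down X F" for p
  proof -
    obtain U where "U \<in> ClopUp X" "p \<in> U" "U \<inter> F = {}"
      using ClopUp_disjoint_closed[OF assms, of p] p unfolding down_def by blast
    then show ?thesis
      using ClopUp_ordD[of U] ClopUp_subset[of U] unfolding down_def ClopUp_iff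
      by (intro exI[of _ U]) blast
  qed
  then have "openin (topo X) (points X - down X F)"
    by (subst openin_subopen) blast
  then show ?thesis
    unfolding closedin_def down_def by auto
qed

lemma closedin_singleton: 
  assumes "x \<in> points X" shows "closedin (topo X) {x}"
proof -
  have "\<exists>T. openin (topo X) T \<and> p \<in> T \<and> T \<subseteq> points X - {x}" if p: "p \<in> points X - {x}" for p
  proof -
    obtain U where "U \<in> ClopUp X" "(p \<in> U) \<noteq> (x \<in> U)"
      using eq_if_same_ClopUp[of p x] p assms by blast
    then show ?thesis
      using p unfolding ClopUp_iff
      by (intro exI[of _ "if p \<in> U then U else points X - U"]) (auto dest: openin_subset)
  qed
  then have "openin (topo X) (points X - {x})"
    by (subst openin_subopen) blast
  then show ?thesis
    using assms unfolding closedin_def by auto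
qed

text \<open>The down-sets of the members of a chain are closed and directed, so by compactness every chain has
a lower bound, and Zorn's lemma applies to the reversed order.\<close>

lemma minimal_below:
  assumes x: "x \<in> points X"
  obtains m where "m \<in> min_elems X (points X)" "(m, x) \<in> ord X"
proof -
  \<comment> \<open>The order reversed, because Zorn's lemma yields maximal elements, and restricted to the
    points below x.\<close>
  define r where "r = {(a, b). (b, a) \<in> ord X \<and> (a, x) \<in> ord X}"
  have F: "Field r = {a. (a, x) \<in> ord X}"
    unfolding r_def Field_def using ord_refl ord_trans ord_in_points by blast
  have "Partial_order r"
    unfolding partial_order_on_def preorder_on_def F
  proof (intro conjI)
    show "r \<subseteq> {a. (a, x) \<in> ord X} \<times> {a. (a, x) \<in> ord X}"
      unfolding r_def using ord_trans by blast
    show "refl_on {a. (a, x) \<in> ord X} r"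
      unfolding r_def refl_on_def using ord_refl ord_in_points by blast
    show "trans r" unfolding r_def trans_def using ord_trans by blast
    show "antisym r" unfolding r_def antisym_def using ord_antisym by blast
  qed
  moreover have "\<exists>u\<in>Field r. \<forall>a\<in>C. (a, u) \<in> r" if C: "C \<in> Chains r" for C
  proof (cases "C = {}")
    case True
    then show ?thesis using F ord_refl[OF x] by blast
  next
    case False
    have Cx: "(c, x) \<in> ord X" if "c \<in> C" for c
      using C that unfolding Chains_def r_def by blast
    have "\<Inter>((\<lambda>c. down X {c}) ` C) \<noteq> {}"
    proof (rule compact_space_directed_Inter[OF Priestley_compact])
      show "(\<lambda>c. down X {c}) ` C \<noteq> {}" using False by blast
      show "closedin (topo X) D" if "D \<in> (\<lambda>c. down X {c}) ` C" for D
        using that closedin_down closedin_singleton Cx ord_in_points by blast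
      show "D \<noteq> {}" if "D \<in> (\<lambda>c. down X {c}) ` C" for D
        using that Cx ord_in_points ord_refl unfolding down_def by blast
      fix D D' assume "D \<in> (\<lambda>c. down X {c}) ` C" "D' \<in> (\<lambda>c. down X {c}) ` C"
      then obtain c c' where c: "c \<in> C" "c' \<in> C" "D = down X {c}" "D' = down X {c'}" by blast
      then have "(c, c') \<in> ord X \<or> (c', c) \<in> ord X"
        using C unfolding Chains_def r_def by blast
      then have "D \<subseteq> D' \<or> D' \<subseteq> D" unfolding c down_def using ord_trans by blast
      then show "\<exists>E\<in>(\<lambda>c. down X {c}) ` C. E \<subseteq> D \<inter> D'" using c by blast
    qed
    then obtain u where "\<And>c. c \<in> C \<Longrightarrow> (u, c) \<in> ord X" unfolding down_def by blast
    then show ?thesis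
      using False Cx F ord_trans unfolding r_def by blast
  qed
  ultimately obtain m where m: "m \<in> Field r" "\<And>a. a \<in> Field r \<Longrightarrow> (m, a) \<in> r \<Longrightarrow> a = m"
    using Zorns_po_lemma[of r] by blast
  have mx: "(m, x) \<in> ord X" using m(1) by (simp add: F)
  have "s = m" if "(s, m) \<in> ord X" for s
    using m(2)[unfolded F, of s] ord_trans[OF that mx] that mx by (simp add: r_def)
  then show ?thesis
    using mx ord_in_points[OF mx] that unfolding min_elems_def by blast
qed

end

text \<open>If \<open>x \<le> y\<close> and a clopen neighbourhood of \<open>y\<close> misses \<open>S\<close>, then its down-closure is an open
neighbourhood of \<open>x\<close> which misses the upset \<open>S\<close>.\<close>

lemma Esakia_closure_upset:
  assumes "Esakia_space X" "upset X S"
  shows "upset X (topo X closure_of S)"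
proof -
  have P: "Priestley_space X" using assms(1) by (simp add: Esakia_space_def)
  have "y \<in> topo X closure_of S" if x: "x \<in> topo X closure_of S" and xy: "(x, y) \<in> ord X" for x y
  proof (rule ccontr)
    assume "y \<notin> topo X closure_of S"
    then obtain W where W: "openin (topo X) W" "y \<in> W" "W \<inter> S = {}"
      using ord_in_points[OF P xy] unfolding in_closure_of by blast
    obtain U V where UV: "U \<in> ClopUp X" "V \<in> ClopUp X" "y \<in> U - V" "U - V \<subseteq> W"
      using ClopUp_basis[OF P W(1,2)] .
    then have "clopen X (U - V)"
      unfolding ClopUp_def clopen_def by (auto intro: openin_diff closedin_diff)
    then have "openin (topo X) (down X (U - V))"
      using assms(1) unfolding Esakia_space_def clopen_def by blast
    moreover have "x \<in> down X (U - V)" using xy UV(3) ord_in_points[OF P xy] unfolding down_def by blast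
    ultimately obtain s where "s \<in> S" "s \<in> down X (U - V)"
      using x unfolding in_closure_of by blast
    then show False
      using assms(2) UV(4) W(3) unfolding upset_iff[OF P] down_def by blast
  qed
  then show ?thesis
    unfolding upset_iff[OF P] using closure_of_subset_topspace by fast
qed

lemma L_space_closure_ClopUp:
  assumes "L_space X" "openin (topo X) U" "upset X U"
  shows "topo X closure_of U \<in> ClopUp X"
  using assms Esakia_closure_upset[of X U] unfolding L_space_def ClopUp_def clopen_def by auto

section \<open>The space of localic points\<close>

text \<open>The sets \<open>U \<inter> Y\<close> with \<open>U\<close> a clopen upset are the same open sets of the localic part \<open>Y\<close> of a
KRL-space, since an open upset and its closure have the same trace (\<open>localic_mem_closure\<close>); with open
upsets it is plain that arbitrary unions of open sets are open. This topology is coarser than the subspace topology: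
in a KRL-space each \<open>{y}\<close> with \<open>y \<in> Y\<close> is open in \<open>X\<close>.\<close>

definition Loc :: "'a ord_space \<Rightarrow> 'a topology" where
  "Loc X = topology (\<lambda>S. \<exists>U. openin (topo X) U \<and> upset X U \<and> S = U \<inter> localic_part X)"

lemma openin_Loc:
  assumes "Priestley_space X"
  shows "openin (Loc X) S \<longleftrightarrow> (\<exists>U. openin (topo X) U \<and> upset X U \<and> S = U \<inter> localic_part X)"
proof -
  let ?L = "\<lambda>S. \<exists>U. openin (topo X) U \<and> upset X U \<and> S = U \<inter> localic_part X"
  have "istopology ?L"
    unfolding istopology_def
  proof (intro conjI allI impI)
    fix S T assume "?L S" "?L T"
    then obtain U V where "openin (topo X) U" "upset X U" "S = U \<inter> localic_part X"
      "openin (topo X) V" "upset X V" "T = V \<inter> localic_part X" by blast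
    then show "?L (S \<inter> T)"
      using upset_Int[OF assms, of U V] by (intro exI[of _ "U \<inter> V"]) auto
  next
    fix \<S> assume "\<forall>S\<in>\<S>. ?L S"
    then obtain u where u: "\<And>S. S \<in> \<S> \<Longrightarrow>
        openin (topo X) (u S) \<and> upset X (u S) \<and> S = u S \<inter> localic_part X"
      by metis
    have "\<Union>\<S> = \<Union>(u ` \<S>) \<inter> localic_part X" using u by blast
    moreover have "openin (topo X) (\<Union>(u ` \<S>))" using u by blast
    moreover have "upset X (\<Union>(u ` \<S>))" using u upset_Union[OF assms, of "u ` \<S>"] by blast
    ultimately show "?L (\<Union>\<S>)" by blast
  qed
  then show ?thesis by (simp add: Loc_def)
qed

lemma topspace_Loc:
  assumes "Priestley_space X"
  shows "topspace (Loc X) = localic_part X"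
proof
  show "topspace (Loc X) \<subseteq> localic_part X"
    using openin_Loc[OF assms] unfolding topspace_def by blast
  have "openin (Loc X) (localic_part X)"
    unfolding openin_Loc[OF assms] using upset_points[OF assms]
    by (intro exI[of _ "points X"]) (auto simp: localic_part_def)
  then show "localic_part X \<subseteq> topspace (Loc X)" by (rule openin_subset)
qed

lemma KRL_L: "KRL_space X \<Longrightarrow> L_space X"
  and KRL_Priestley: "KRL_space X \<Longrightarrow> Priestley_space X"
  by (auto simp: KRL_space_def L_space_def Esakia_space_def)

lemma localic_points: "y \<in> localic_part X \<Longrightarrow> y \<in> points X"
  by (simp add: localic_part_def)

lemma openin_reg: "openin (topo X) (reg X U)"
  unfolding reg_def ClopUp_def clopen_def by blast

lemma upset_reg: "Priestley_space X \<Longrightarrow> upset X (reg X U)"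
  unfolding reg_def by (rule upset_Union) (auto simp: ClopUp_def)

context
  fixes X :: "'a ord_space"
  assumes KRL: "KRL_space X"
begin

text \<open>The down-set of a localic point \<open>y\<close> is an open neighbourhood of \<open>y\<close>, so it meets \<open>W\<close>, which
then contains \<open>y\<close>. This converts statements about closures and density into statements about
points.\<close>

lemma localic_mem_closure:
  assumes "y \<in> localic_part X" "upset X W" "y \<in> topo X closure_of W"
  shows "y \<in> W"
proof -
  have "openin (topo X) (down X {y})" "y \<in> down X {y}"
    using assms(1) ord_refl[OF KRL_Priestley[OF KRL]] unfolding localic_part_def clopen_def down_def by auto
  then obtain x where "x \<in> W" "x \<in> down X {y}"
    using assms(3) unfolding in_closure_of by blast
  then show ?thesis using assms(2) unfolding upset_iff[OF KRL_Priestley[OF KRL]] down_def by blast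
qed

text \<open>On localic points, density of the regular part of \<open>U\<close> in \<open>U\<close> becomes equality.\<close>

lemma localic_well_inside:
  assumes "y \<in> localic_part X" "U \<in> ClopUp X" "y \<in> U"
  obtains V where "V \<in> ClopUp X" "y \<in> V" "down X V \<subseteq> U"
proof -
  have "y \<in> topo X closure_of (reg X U)"
    using KRL assms(2,3) unfolding KRL_space_def L_regular_def by blast
  then have "y \<in> reg X U"
    using localic_mem_closure[OF assms(1) upset_reg[OF KRL_Priestley[OF KRL]]] by blast
  then show ?thesis using that unfolding reg_def well_inside_def by blast
qed

text \<open>If \<open>x < y\<close> with \<open>y\<close> localic, a clopen upset containing \<open>y\<close> but not \<open>x\<close> would contain the
down-closure of a neighbourhood of \<open>y\<close>, and hence \<open>x\<close>.\<close>

lemma localic_minimal: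
  assumes y: "y \<in> localic_part X" and xy: "(x, y) \<in> ord X"
  shows "x = y"
proof (rule ccontr)
  assume "x \<noteq> y"
  then have "(y, x) \<notin> ord X" using xy ord_antisym[OF KRL_Priestley[OF KRL]] by blast
  moreover have xp: "x \<in> points X" "y \<in> points X" using ord_in_points[OF KRL_Priestley[OF KRL] xy] by auto
  ultimately obtain U where U: "U \<in> ClopUp X" "y \<in> U" "x \<notin> U"
    using Priestley_separation[OF KRL_Priestley[OF KRL]] by metis
  obtain V where "V \<in> ClopUp X" "y \<in> V" "down X V \<subseteq> U" using localic_well_inside[OF y U(1,2)] .
  then show False using xy xp U(3) unfolding down_def by blast
qed

lemma localic_part_eq_min: "localic_part X = min_elems X (points X)"
proof
  show "localic_part X \<subseteq> min_elems X (points X)"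
    unfolding min_elems_def by (blast intro: localic_minimal localic_points[of _ X])
  show "min_elems X (points X) \<subseteq> localic_part X"
    using KRL unfolding KRL_space_def L_compact_def Scott_upset_def by blast
qed

lemma localic_below:
  assumes "x \<in> points X"
  obtains y where "y \<in> localic_part X" "(y, x) \<in> ord X"
  using minimal_below[OF KRL_Priestley[OF KRL] assms] localic_part_eq_min by metis

text \<open>Otherwise the nonempty open set \<open>U - V\<close> meets the regular part of \<open>U\<close>. A localic point below a point
in the intersection still lies in \<open>U\<close>, as that point is well inside \<open>U\<close>, but it cannot lie in the upset \<open>V\<close>.\<close>

lemma ClopUp_le_if_trace_le:
  assumes U: "U \<in> ClopUp X" and V: "V \<in> ClopUp X" and le: "U \<inter> localic_part X \<subseteq> V"
  shows "U \<subseteq> V"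
proof (rule ccontr)
  assume "\<not> U \<subseteq> V"
  then obtain p where p: "p \<in> U - V" by blast
  have "p \<in> topo X closure_of (reg X U)"
    using KRL U p unfolding KRL_space_def L_regular_def by blast
  moreover have "openin (topo X) (U - V)"
    using U V unfolding ClopUp_iff[OF KRL_Priestley[OF KRL]] by (auto intro: openin_diff)
  ultimately obtain x where x: "x \<in> reg X U" "x \<in> U - V"
    using p unfolding in_closure_of by blast
  then obtain W where W: "x \<in> W" "down X W \<subseteq> U"
    unfolding reg_def well_inside_def by blast
  have "x \<in> points X" using x(2) ClopUp_subset[OF KRL_Priestley[OF KRL] U] by blast
  then obtain y where y: "y \<in> localic_part X" "(y, x) \<in> ord X" using localic_below by blast
  then have "y \<in> U" using W localic_points[of _ X] unfolding down_def by blast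
  then have "y \<in> V" using le y by blast
  then show False using ClopUp_ordD[OF KRL_Priestley[OF KRL] V _ y(2)] x(2) by blast
qed

lemma ClopUp_eq_if_trace_eq:
  assumes "U \<in> ClopUp X" "V \<in> ClopUp X" "U \<inter> localic_part X = V \<inter> localic_part X"
  shows "U = V"
  using assms ClopUp_le_if_trace_le by (metis Int_lower1 subset_antisym)

lemma ClopUp_trace_exists:
  assumes "openin (Loc X) S"
  obtains U where "U \<in> ClopUp X" "U \<inter> localic_part X = S"
proof -
  obtain W where W: "openin (topo X) W" "upset X W" "S = W \<inter> localic_part X"
    using assms openin_Loc[OF KRL_Priestley[OF KRL]] by blast
  have "W \<subseteq> topo X closure_of W" using W(1) by (intro closure_of_subset openin_subset)
  then have "(topo X closure_of W) \<inter> localic_part X = S"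
    unfolding W(3) by (blast intro: localic_mem_closure[OF _ W(2)])
  then show ?thesis using that L_space_closure_ClopUp[OF KRL_L[OF KRL] W(1,2)] by blast
qed

text \<open>Every point of \<open>X\<close> lies above a localic point, so open upsets whose traces cover the localic part
cover \<open>X\<close>.\<close>

lemma compact_space_Loc: "compact_space (Loc X)"
  unfolding compact_space_alt
proof (intro allI impI, elim conjE)
  fix \<U> assume op: "\<forall>U\<in>\<U>. openin (Loc X) U" and cov: "topspace (Loc X) \<subseteq> \<Union>\<U>"
  obtain u where u: "\<And>S. S \<in> \<U> \<Longrightarrow>
      openin (topo X) (u S) \<and> upset X (u S) \<and> S = u S \<inter> localic_part X"
    using op unfolding openin_Loc[OF KRL_Priestley[OF KRL]] by metis
  have "points X \<subseteq> \<Union>(u ` \<U>)"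
  proof
    fix x assume "x \<in> points X"
    then obtain y where y: "y \<in> localic_part X" "(y, x) \<in> ord X" using localic_below by blast
    then obtain S where "S \<in> \<U>" "y \<in> S" using cov topspace_Loc[OF KRL_Priestley[OF KRL]] by blast
    then have "x \<in> u S" using u y(2) unfolding upset_iff[OF KRL_Priestley[OF KRL]] by blast
    then show "x \<in> \<Union>(u ` \<U>)" using \<open>S \<in> \<U>\<close> by blast
  qed
  moreover have "\<forall>U \<in> u ` \<U>. openin (topo X) U" using u by blast
  ultimately obtain \<F> where "finite \<F>" "\<F> \<subseteq> u ` \<U>" "points X \<subseteq> \<Union>\<F>"
    using Priestley_compact[OF KRL_Priestley[OF KRL]] unfolding compact_space_alt by meson
  then obtain \<G> where \<G>: "finite \<G>" "\<G> \<subseteq> \<U>" "points X \<subseteq> \<Union>(u ` \<G>)"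
    by (metis finite_subset_image)
  have "topspace (Loc X) \<subseteq> \<Union>\<G>"
  proof
    fix y assume "y \<in> topspace (Loc X)"
    then have y: "y \<in> localic_part X" by (simp add: topspace_Loc[OF KRL_Priestley[OF KRL]])
    then obtain S where "S \<in> \<G>" "y \<in> u S" using \<G>(3) localic_points[of _ X] by blast
    then show "y \<in> \<Union>\<G>" using u[of S] \<G>(2) y by blast
  qed
  then show "\<exists>\<F>. finite \<F> \<and> \<F> \<subseteq> \<U> \<and> topspace (Loc X) \<subseteq> \<Union>\<F>" using \<G> by blast
qed

text \<open>For \<open>y\<close> in \<open>V\<close> with \<open>V\<close> well inside a clopen upset missing \<open>z\<close>, the traces of \<open>V\<close> and of the
open upset complementary to the down-closure of \<open>V\<close> separate \<open>y\<close> and \<open>z\<close>.\<close>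

lemma Hausdorff_space_Loc: "Hausdorff_space (Loc X)"
  unfolding Hausdorff_space_def topspace_Loc[OF KRL_Priestley[OF KRL]]
proof (intro allI impI, elim conjE)
  fix y z assume y: "y \<in> localic_part X" and z: "z \<in> localic_part X" and "y \<noteq> z"
  then have "(y, z) \<notin> ord X" using localic_minimal by blast
  then obtain U where U: "U \<in> ClopUp X" "y \<in> U" "z \<notin> U"
    using Priestley_separation[OF KRL_Priestley[OF KRL]] localic_points[of _ X] y z by metis
  obtain V where V: "V \<in> ClopUp X" "y \<in> V" "down X V \<subseteq> U" using localic_well_inside[OF y U(1,2)] .
  have Vc: "openin (topo X) V" "closedin (topo X) V" "upset X V" using V(1) ClopUp_iff[OF KRL_Priestley[OF KRL]] by auto
  let ?W = "points X - down X V"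
  have "openin (topo X) ?W" using closedin_down[OF KRL_Priestley[OF KRL] Vc(2)] by blast
  moreover have "upset X ?W"
    unfolding upset_iff[OF KRL_Priestley[OF KRL]] down_def using ord_trans[OF KRL_Priestley[OF KRL]] ord_in_points[OF KRL_Priestley[OF KRL]] by blast
  moreover have "z \<in> ?W" using V(3) U(3) localic_points[OF z] by blast
  moreover have "V \<inter> ?W = {}"
    using ord_refl[OF KRL_Priestley[OF KRL]] unfolding down_def by blast
  ultimately have "openin (Loc X) (V \<inter> localic_part X)" "openin (Loc X) (?W \<inter> localic_part X)"
    "y \<in> V \<inter> localic_part X" "z \<in> ?W \<inter> localic_part X"
    "disjnt (V \<inter> localic_part X) (?W \<inter> localic_part X)"
    using Vc V(2) y z unfolding openin_Loc[OF KRL_Priestley[OF KRL]] disjnt_def by blast+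
  then show "\<exists>U V. openin (Loc X) U \<and> openin (Loc X) V \<and> y \<in> U \<and> z \<in> V \<and> disjnt U V"
    by blast
qed

end

section \<open>L-morphisms are the continuous maps between localic points\<close>

context
  fixes X1 :: "'a ord_space" and X2 :: "'b ord_space"
  assumes K1: "KRL_space X1" and K2: "KRL_space X2"
begin

lemma L_morphism_points:
  assumes "L_morphism X1 X2 f" "x \<in> points X1" shows "f x \<in> points X2"
  using assms unfolding L_morphism_def continuous_map_def by blast

lemma L_morphism_vimage_upset:
  assumes f: "L_morphism X1 X2 f" and U: "upset X2 U"
  shows "upset X1 {x \<in> points X1. f x \<in> U}"
  using f U ord_in_points[OF KRL_Priestley[OF K1]]
  unfolding upset_iff[OF KRL_Priestley[OF K1]] upset_iff[OF KRL_Priestley[OF K2]] L_morphism_def by blast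

lemma L_morphism_vimage_open:
  assumes f: "L_morphism X1 X2 f" and U: "openin (topo X2) U"
  shows "openin (topo X1) {x \<in> points X1. f x \<in> U}"
  using f U unfolding L_morphism_def continuous_map_def by blast

lemma L_morphism_vimage_ClopUp:
  assumes f: "L_morphism X1 X2 f" and U: "U \<in> ClopUp X2"
  shows "{x \<in> points X1. f x \<in> U} \<in> ClopUp X1"
  using U L_morphism_vimage_upset[OF f] L_morphism_vimage_open[OF f]
    closedin_continuous_map_preimage[of "topo X1" "topo X2" f U] f
  unfolding ClopUp_iff[OF KRL_Priestley[OF K1]] ClopUp_iff[OF KRL_Priestley[OF K2]] L_morphism_def by blast

text \<open>This is where preservation of closures is needed. If \<open>m < f y\<close>, take a clopen upset \<open>U\<close> with
\<open>f y\<close> inside and \<open>m\<close> outside. Since \<open>f y\<close> is in the closure of the regular part of \<open>U\<close>, the point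
\<open>y\<close> is in the closure of the preimage of this regular part, and hence in the preimage, as \<open>y\<close> is
localic. So \<open>f y\<close> is well inside \<open>U\<close>, which forces \<open>m\<close> into \<open>U\<close>.\<close>

lemma L_morphism_localic:
  assumes f: "L_morphism X1 X2 f" and y: "y \<in> localic_part X1"
  shows "f y \<in> localic_part X2"
proof -
  have fy: "f y \<in> points X2" using L_morphism_points[OF f localic_points[OF y]] .
  have "m = f y" if m: "(m, f y) \<in> ord X2" for m
  proof (rule ccontr)
    assume "m \<noteq> f y"
    then have "(f y, m) \<notin> ord X2" using m ord_antisym[OF KRL_Priestley[OF K2]] by blast
    moreover have mp: "m \<in> points X2" using ord_in_points[OF KRL_Priestley[OF K2] m] by blast
    ultimately obtain U where U: "U \<in> ClopUp X2" "f y \<in> U" "m \<notin> U"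
      using Priestley_separation[OF KRL_Priestley[OF K2] fy] by metis
    have "f y \<in> topo X2 closure_of (reg X2 U)"
      using K2 U unfolding KRL_space_def L_regular_def by blast
    then have "y \<in> topo X1 closure_of {x \<in> points X1. f x \<in> reg X2 U}"
      using f openin_reg[of X2 U] upset_reg[OF KRL_Priestley[OF K2], of U] localic_points[OF y]
      unfolding L_morphism_def by blast
    then have "f y \<in> reg X2 U"
      using localic_mem_closure[OF K1 y L_morphism_vimage_upset[OF f upset_reg[OF KRL_Priestley[OF K2]]]]
      by blast
    then have "m \<in> U" using m mp unfolding reg_def well_inside_def down_def by blast
    then show False using U(3) by blast
  qed
  then show ?thesis
    using fy unfolding localic_part_eq_min[OF K2] min_elems_def by blast
qed

lemma L_morphism_continuous_Loc:
  assumes f: "L_morphism X1 X2 f"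
  shows "continuous_map (Loc X1) (Loc X2) f"
  unfolding continuous_map_def topspace_Loc[OF KRL_Priestley[OF K1]] topspace_Loc[OF KRL_Priestley[OF K2]]
proof (intro conjI allI impI)
  show "f \<in> localic_part X1 \<rightarrow> localic_part X2" using L_morphism_localic[OF f] by blast
  fix S assume "openin (Loc X2) S"
  then obtain U where U: "openin (topo X2) U" "upset X2 U" "S = U \<inter> localic_part X2"
    using openin_Loc[OF KRL_Priestley[OF K2]] by blast
  have "{x \<in> localic_part X1. f x \<in> S} = {x \<in> points X1. f x \<in> U} \<inter> localic_part X1"
    using L_morphism_localic[OF f] localic_points[of _ X1] unfolding U(3) by blast
  then show "openin (Loc X1) {x \<in> localic_part X1. f x \<in> S}"
    using L_morphism_vimage_upset[OF f U(2)] L_morphism_vimage_open[OF f U(1)]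
    unfolding openin_Loc[OF KRL_Priestley[OF K1]] by blast
qed

lemma L_morphism_eq_if_eq_localic:
  assumes f: "L_morphism X1 X2 f" and g: "L_morphism X1 X2 g"
    and eq: "\<And>y. y \<in> localic_part X1 \<Longrightarrow> f y = g y" and x: "x \<in> points X1"
  shows "f x = g x"
proof (rule eq_if_same_ClopUp[OF KRL_Priestley[OF K2]])
  show "f x \<in> points X2" "g x \<in> points X2" using L_morphism_points f g x by auto
  fix U assume U: "U \<in> ClopUp X2"
  have "{x \<in> points X1. f x \<in> U} = {x \<in> points X1. g x \<in> U}"
  proof (rule ClopUp_eq_if_trace_eq[OF K1])
    show "{x \<in> points X1. f x \<in> U} \<inter> localic_part X1 = {x \<in> points X1. g x \<in> U} \<inter> localic_part X1"
      using eq by auto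
  qed (intro L_morphism_vimage_ClopUp f g U)+
  then show "f x \<in> U \<longleftrightarrow> g x \<in> U" using x by blast
qed

text \<open>The map \<open>h\<close> in the proof sends a clopen upset \<open>U\<close> to the clopen upset whose trace is the preimage
of the trace of \<open>U\<close>. It preserves the lattice operations because traces determine clopen upsets,
so the clopen upsets \<open>U\<close> with \<open>x \<in> h U\<close> form a prime filter, and compactness provides the point
\<open>f x\<close> that lies in exactly these.\<close>

lemma L_morphism_extension:
  assumes g: "continuous_map (Loc X1) (Loc X2) g"
  obtains f where "L_morphism X1 X2 f" "\<And>y. y \<in> localic_part X1 \<Longrightarrow> f y = g y"
proof -
  note P1 = KRL_Priestley[OF K1] and P2 = KRL_Priestley[OF K2]
  have gY: "g y \<in> localic_part X2" if "y \<in> localic_part X1" for y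
    using continuous_map_image_subset_topspace[OF g] that topspace_Loc[OF P1] topspace_Loc[OF P2] by blast
  have "\<exists>W. W \<in> ClopUp X1 \<and> W \<inter> localic_part X1 = {y \<in> localic_part X1. g y \<in> U}"
    if U: "U \<in> ClopUp X2" for U
  proof -
    have "openin (Loc X2) (U \<inter> localic_part X2)"
      using U unfolding openin_Loc[OF P2] ClopUp_iff[OF P2] by blast
    then have "openin (Loc X1) {y \<in> topspace (Loc X1). g y \<in> U \<inter> localic_part X2}"
      using g unfolding continuous_map_def by blast
    moreover have "{y \<in> topspace (Loc X1). g y \<in> U \<inter> localic_part X2} = {y \<in> localic_part X1. g y \<in> U}"
      unfolding topspace_Loc[OF P1] using gY by blast
    ultimately show ?thesis using ClopUp_trace_exists[OF K1] by metis
  qed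
  then obtain h where h: "\<And>U. U \<in> ClopUp X2 \<Longrightarrow> h U \<in> ClopUp X1"
    and tr: "\<And>U. U \<in> ClopUp X2 \<Longrightarrow> h U \<inter> localic_part X1 = {y \<in> localic_part X1. g y \<in> U}"
    by metis
  have h_mono: "h U \<subseteq> h V" if U: "U \<in> ClopUp X2" and V: "V \<in> ClopUp X2" and "U \<subseteq> V" for U V
    using ClopUp_le_if_trace_le[OF K1 h[OF U] h[OF V]] tr[OF U] tr[OF V] \<open>U \<subseteq> V\<close> by blast
  have h_Int: "h (U \<inter> V) = h U \<inter> h V" if U: "U \<in> ClopUp X2" and V: "V \<in> ClopUp X2" for U V
  proof (rule ClopUp_eq_if_trace_eq[OF K1])
    have UV: "U \<inter> V \<in> ClopUp X2" using ClopUp_Int[OF P2 U V] .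
    show "h (U \<inter> V) \<in> ClopUp X1" "h U \<inter> h V \<in> ClopUp X1"
      using h UV ClopUp_Int[OF P1 h[OF U] h[OF V]] by auto
    show "h (U \<inter> V) \<inter> localic_part X1 = (h U \<inter> h V) \<inter> localic_part X1"
      using tr[OF U] tr[OF V] tr[OF UV] by blast
  qed
  have h_Un: "h (U \<union> V) = h U \<union> h V" if U: "U \<in> ClopUp X2" and V: "V \<in> ClopUp X2" for U V
  proof (rule ClopUp_eq_if_trace_eq[OF K1])
    have UV: "U \<union> V \<in> ClopUp X2" using ClopUp_Un[OF P2 U V] .
    show "h (U \<union> V) \<in> ClopUp X1" "h U \<union> h V \<in> ClopUp X1"
      using h UV ClopUp_Un[OF P1 h[OF U] h[OF V]] by auto
    show "h (U \<union> V) \<inter> localic_part X1 = (h U \<union> h V) \<inter> localic_part X1"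
      using tr[OF U] tr[OF V] tr[OF UV] by blast
  qed
  have h_empty: "h {} = {}"
  proof (rule ClopUp_eq_if_trace_eq[OF K1 h[OF ClopUp_empty[OF P2]] ClopUp_empty[OF P1]])
    show "h {} \<inter> localic_part X1 = {} \<inter> localic_part X1"
      using tr[OF ClopUp_empty[OF P2]] by simp
  qed
  have h_top: "h (points X2) = points X1"
  proof (rule ClopUp_eq_if_trace_eq[OF K1 h[OF ClopUp_points[OF P2]] ClopUp_points[OF P1]])
    show "h (points X2) \<inter> localic_part X1 = points X1 \<inter> localic_part X1"
      unfolding tr[OF ClopUp_points[OF P2]] using gY by (auto intro: localic_points)
  qed
  have "\<exists>p. p \<in> points X2 \<and> (\<forall>U\<in>ClopUp X2. p \<in> U \<longleftrightarrow> x \<in> h U)" if x: "x \<in> points X1" for x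
  proof (rule ccontr)
    assume *: "\<not> ?thesis"
    define \<U> \<V> where "\<U> = {U \<in> ClopUp X2. x \<in> h U}" and "\<V> = {V \<in> ClopUp X2. x \<notin> h V}"
    obtain U V where UV: "U \<in> \<U>" "V \<in> \<V>" "points X2 \<inter> U \<subseteq> V"
    proof (rule compact_separation[OF Priestley_compact[OF P2], of "points X2" \<U> \<V>])
      show "\<U> \<noteq> {}" using ClopUp_points[OF P2] h_top x by (auto simp: \<U>_def)
      show "\<V> \<noteq> {}" using ClopUp_empty[OF P2] h_empty by (auto simp: \<V>_def)
      show "points X2 \<inter> \<Inter> \<U> \<subseteq> \<Union> \<V>" using * unfolding \<U>_def \<V>_def by blast
    qed (auto simp: \<U>_def \<V>_def ClopUp_Int[OF P2] ClopUp_Un[OF P2] h_Int h_Un,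
         auto simp: ClopUp_iff[OF P2])
    then have "U \<subseteq> V" using ClopUp_subset[OF P2] unfolding \<U>_def by blast
    then show False using UV h_mono unfolding \<U>_def \<V>_def by blast
  qed
  then obtain f where f: "\<And>x. x \<in> points X1 \<Longrightarrow> f x \<in> points X2"
    and fh: "\<And>x U. x \<in> points X1 \<Longrightarrow> U \<in> ClopUp X2 \<Longrightarrow> f x \<in> U \<longleftrightarrow> x \<in> h U"
    by metis
  have vim: "{x \<in> points X1. f x \<in> U} = h U" if "U \<in> ClopUp X2" for U
    using fh that ClopUp_subset[OF P1 h] by blast
  have cont: "continuous_map (topo X1) (topo X2) f"
    unfolding continuous_map_def
  proof (intro conjI allI impI)
    show "f \<in> points X1 \<rightarrow> points X2" using f by blast
    fix W assume W: "openin (topo X2) W"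
    have "\<exists>T. openin (topo X1) T \<and> x \<in> T \<and> T \<subseteq> {x \<in> points X1. f x \<in> W}"
      if x: "x \<in> {x \<in> points X1. f x \<in> W}" for x
    proof -
      obtain U V where UV: "U \<in> ClopUp X2" "V \<in> ClopUp X2" "f x \<in> U - V" "U - V \<subseteq> W"
        using ClopUp_basis[OF P2 W] x by blast
      have "openin (topo X1) (h U - h V)"
        using h UV unfolding ClopUp_iff[OF P1] by (auto intro: openin_diff)
      moreover have "h U - h V = {x \<in> points X1. f x \<in> U - V}" using vim[of U] vim[of V] UV by blast
      ultimately show ?thesis using UV x by (intro exI[of _ "h U - h V"]) blast
    qed
    then show "openin (topo X1) {x \<in> points X1. f x \<in> W}" by (subst openin_subopen) blast
  qed
  have mono: "(f x, f y) \<in> ord X2" if xy: "(x, y) \<in> ord X1" for x y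
  proof -
    have p: "x \<in> points X1" "y \<in> points X1" using ord_in_points[OF P1 xy] by auto
    have "f y \<in> U" if U: "U \<in> ClopUp X2" and "f x \<in> U" for U
      using ClopUp_ordD[OF P1 h[OF U] _ xy] fh[OF p(1) U] fh[OF p(2) U] that(2) by blast
    then show ?thesis
      using ord_iff_ClopUp[OF P2 f[OF p(1)] f[OF p(2)]] by blast
  qed
  have fg: "f y = g y" if y: "y \<in> localic_part X1" for y
  proof (rule eq_if_same_ClopUp[OF P2])
    show "f y \<in> points X2" using f localic_points[OF y] .
    show "g y \<in> points X2" using localic_points[OF gY[OF y]] .
    show "f y \<in> U \<longleftrightarrow> g y \<in> U" if U: "U \<in> ClopUp X2" for U
      using fh[OF localic_points[OF y] U] tr[OF U] y by blast
  qed
  have "{x \<in> points X1. f x \<in> topo X2 closure_of W} = topo X1 closure_of {x \<in> points X1. f x \<in> W}"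
    if W: "openin (topo X2) W" "upset X2 W" for W
  proof (rule ClopUp_eq_if_trace_eq[OF K1])
    have cW: "topo X2 closure_of W \<in> ClopUp X2" using L_space_closure_ClopUp[OF KRL_L[OF K2] W] .
    then show "{x \<in> points X1. f x \<in> topo X2 closure_of W} \<in> ClopUp X1" using vim h by simp
    have o: "openin (topo X1) {x \<in> points X1. f x \<in> W}"
      using cont W(1) unfolding continuous_map_def by blast
    have u: "upset X1 {x \<in> points X1. f x \<in> W}"
      using W(2) mono ord_in_points[OF P1] unfolding upset_iff[OF P1] upset_iff[OF P2] by blast
    show "topo X1 closure_of {x \<in> points X1. f x \<in> W} \<in> ClopUp X1"
      using L_space_closure_ClopUp[OF KRL_L[OF K1] o u] .
    have "f y \<in> topo X2 closure_of W \<longleftrightarrow> y \<in> topo X1 closure_of {x \<in> points X1. f x \<in> W}"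
      if y: "y \<in> localic_part X1" for y
    proof -
      have "f y \<in> localic_part X2" using fg gY y by simp
      moreover have "W \<subseteq> topo X2 closure_of W"
        using W(1) by (intro closure_of_subset openin_subset)
      ultimately have "f y \<in> topo X2 closure_of W \<longleftrightarrow> f y \<in> W"
        using localic_mem_closure[OF K2 _ W(2)] by blast
      moreover have "{x \<in> points X1. f x \<in> W} \<subseteq> topo X1 closure_of {x \<in> points X1. f x \<in> W}"
        by (rule closure_of_subset) blast
      then have "y \<in> topo X1 closure_of {x \<in> points X1. f x \<in> W} \<longleftrightarrow> f y \<in> W"
        using localic_mem_closure[OF K1 y u] localic_points[OF y] by blast
      ultimately show ?thesis by blast
    qed
    then show "{x \<in> points X1. f x \<in> topo X2 closure_of W} \<inter> localic_part X1 =
        topo X1 closure_of {x \<in> points X1. f x \<in> W} \<inter> localic_part X1"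
      by (auto intro: localic_points)
  qed
  then have "L_morphism X1 X2 f" unfolding L_morphism_def using cont mono by blast
  then show ?thesis using that fg by blast
qed

end

section \<open>The spectrum of the frame of opens\<close>

definition prime_filters :: "'a topology \<Rightarrow> 'a set set set" where
  "prime_filters Z = {P. P \<subseteq> Collect (openin Z) \<and> topspace Z \<in> P \<and> {} \<notin> P \<and>
     (\<forall>A B. openin Z A \<and> openin Z B \<longrightarrow>
        (A \<inter> B \<in> P \<longleftrightarrow> A \<in> P \<and> B \<in> P) \<and> (A \<union> B \<in> P \<longleftrightarrow> A \<in> P \<or> B \<in> P))}"

text \<open>The prime filters of opens of \<open>Z\<close>, ordered by inclusion and topologised as a subspace of the power of the
discrete two-point space indexed by all sets. The points are taken from an arbitrary set
\<open>S\<close>, where \<open>p\<close> stands for the prime filter \<open>e p\<close>, so that the space can be placed in any type with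
enough room without transporting structure along a bijection afterwards.\<close>

definition spectrum_space :: "'a topology \<Rightarrow> 'b set \<Rightarrow> ('b \<Rightarrow> 'a set set) \<Rightarrow> 'b ord_space" where
  "spectrum_space Z S e =
     \<lparr>topo = pullback_topology S (\<lambda>p A. A \<in> e p) euclidean,
      ord = {(p, q). p \<in> S \<and> q \<in> S \<and> e p \<subseteq> e q}\<rparr>"

lemma clopen_coordinate:
  fixes A :: 'a
  shows "open {c. c A :: bool}" "closed {c. c A :: bool}"
proof -
  have cont: "continuous_on UNIV (\<lambda>c :: 'a \<Rightarrow> bool. c A)"
    by (rule continuous_on_product_coordinates)
  have "(\<lambda>c :: 'a \<Rightarrow> bool. c A) -` {True} = {c. c A}" by auto
  moreover have "open {True}" "closed {True}" by (auto simp: open_discrete)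
  ultimately show "open {c. c A :: bool}" "closed {c. c A :: bool}"
    using open_vimage[OF _ cont, of "{True}"] closed_vimage[OF _ cont, of "{True}"] by auto
qed

text \<open>Each instance of a clause in the definition of a prime filter constrains at most three coordinates,
so prime filters form an intersection of closed subsets of the compact power of the two-point space.\<close>

lemma compact_prime_filters: "compact ((\<lambda>P A. A \<in> P) ` prime_filters Z)"
proof -
  have eq: "(\<lambda>P A. A \<in> P) ` prime_filters Z =
      {c. \<forall>A. c A \<longrightarrow> openin Z A} \<inter> {c. c (topspace Z)} \<inter> {c. \<not> c {}} \<inter>
      (\<Inter>A\<in>Collect (openin Z). \<Inter>B\<in>Collect (openin Z).
         {c. (c (A \<inter> B) \<longrightarrow> c A \<and> c B) \<and> (c A \<and> c B \<longrightarrow> c (A \<inter> B)) \<and>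
             (c (A \<union> B) \<longrightarrow> c A \<or> c B) \<and> (c A \<or> c B \<longrightarrow> c (A \<union> B))})"
    (is "_ = ?R")
  proof
    show "(\<lambda>P A. A \<in> P) ` prime_filters Z \<subseteq> ?R"
    proof (rule image_subsetI)
      fix P assume "P \<in> prime_filters Z"
      then show "(\<lambda>A. A \<in> P) \<in> ?R"
        unfolding prime_filters_def by blast
    qed
    show "?R \<subseteq> (\<lambda>P A. A \<in> P) ` prime_filters Z"
    proof
      fix c assume "c \<in> ?R"
      then have c: "\<And>A. c A \<Longrightarrow> openin Z A" "c (topspace Z)" "\<not> c {}"
        "\<And>A B. openin Z A \<Longrightarrow> openin Z B \<Longrightarrow>
           (c (A \<inter> B) \<longleftrightarrow> c A \<and> c B) \<and> (c (A \<union> B) \<longleftrightarrow> c A \<or> c B)"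
        unfolding Int_iff INT_iff mem_Collect_eq by blast+
      have "Collect c \<in> prime_filters Z"
        unfolding prime_filters_def mem_Collect_eq using c(1) c(2,3) by (intro conjI allI impI c(4)) auto
      then show "c \<in> (\<lambda>P A. A \<in> P) ` prime_filters Z"
        by (rule rev_image_eqI) simp
    qed
  qed
  have "closed ?R"
    by (intro closed_Int closed_INT ballI, auto intro!: closed_Collect_all closed_Collect_imp closed_Collect_conj closed_Collect_disj
          closed_Collect_neg open_Collect_conj open_Collect_disj clopen_coordinate)
  moreover have "compact (UNIV :: ('a set \<Rightarrow> bool) set)"
  proof -
    have "compact_space (product_topology (\<lambda>_. euclidean :: bool topology) (UNIV :: 'a set set))"
      unfolding compact_space_product_topology by (simp add: compact_space_def finite_imp_compact)
    then show ?thesis unfolding euclidean_product_topology compact_space_def by simp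
  qed
  ultimately show ?thesis unfolding eq using closed_Int_compact[of ?R UNIV] by auto
qed

lemma compact_space_pullback:
  assumes "compact (f ` S)"
  shows "compact_space (pullback_topology S f euclidean)"
  unfolding compact_space_alt
proof (intro allI impI, elim conjE)
  fix \<U> assume op: "\<forall>U\<in>\<U>. openin (pullback_topology S f euclidean) U"
    and cov: "topspace (pullback_topology S f euclidean) \<subseteq> \<Union>\<U>"
  obtain u where u: "\<And>U. U \<in> \<U> \<Longrightarrow> open (u U) \<and> U = f -` u U \<inter> S"
    using op unfolding openin_pullback_topology open_openin[symmetric] by metis
  have "S \<subseteq> \<Union>\<U>" using cov by (simp add: topspace_pullback_topology)
  then have "f ` S \<subseteq> \<Union>(u ` \<U>)" using u by blast
  then obtain \<F> where "\<F> \<subseteq> u ` \<U>" "finite \<F>" "f ` S \<subseteq> \<Union>\<F>"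
    using compactE[OF assms, of "u ` \<U>"] u by blast
  then obtain \<G> where \<G>: "finite \<G>" "\<G> \<subseteq> \<U>" "f ` S \<subseteq> \<Union>(u ` \<G>)"
    by (metis finite_subset_image)
  have "S \<subseteq> \<Union>\<G>"
  proof
    fix x assume x: "x \<in> S"
    then obtain U where "U \<in> \<G>" "f x \<in> u U" using \<G>(3) by blast
    then show "x \<in> \<Union>\<G>" using u[of U] \<G>(2) x by blast
  qed
  then show "\<exists>\<F>. finite \<F> \<and> \<F> \<subseteq> \<U> \<and> topspace (pullback_topology S f euclidean) \<subseteq> \<Union>\<F>"
    using \<G> by (auto simp: topspace_pullback_topology)
qed

locale spectrum =
  fixes Z :: "'a topology" and S :: "'b set" and e :: "'b \<Rightarrow> 'a set set"
  assumes e: "bij_betw e S (prime_filters Z)"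
begin

abbreviation X :: "'b ord_space" where
  "X \<equiv> spectrum_space Z S e"

definition phi :: "'a set \<Rightarrow> 'b set" where
  "phi A = {p \<in> S. A \<in> e p}"

lemma points_spectrum: "points X = S"
  by (simp add: spectrum_space_def topspace_pullback_topology)

lemma ord_spectrum: "(p, q) \<in> ord X \<longleftrightarrow> p \<in> S \<and> q \<in> S \<and> e p \<subseteq> e q"
  by (simp add: spectrum_space_def)

lemma prime_filter_e: "p \<in> S \<Longrightarrow> e p \<in> prime_filters Z"
  using e by (auto simp: bij_betw_def)

lemma
  assumes p: "p \<in> S"
  shows e_open: "A \<in> e p \<Longrightarrow> openin Z A"
    and e_top: "topspace Z \<in> e p"
    and e_empty: "{} \<notin> e p"
    and e_Int: "openin Z A \<Longrightarrow> openin Z B \<Longrightarrow> A \<inter> B \<in> e p \<longleftrightarrow> A \<in> e p \<and> B \<in> e p"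
    and e_Un: "openin Z A \<Longrightarrow> openin Z B \<Longrightarrow> A \<union> B \<in> e p \<longleftrightarrow> A \<in> e p \<or> B \<in> e p"
  using prime_filter_e[OF p] unfolding prime_filters_def by auto

lemma e_mono:
  assumes "p \<in> S" "A \<in> e p" "A \<subseteq> B" "openin Z B" shows "B \<in> e p"
  using e_Int[OF assms(1) e_open[OF assms(1,2)] assms(4)] assms(2,3) by (simp add: Int_absorb2)

text \<open>The sets \<open>phi A\<close> and their complements are the preimages of the coordinate half-spaces.\<close>

lemma phi_ClopUp: "phi A \<in> ClopUp X"
proof -
  have *: "openin (topo X) {p \<in> S. Q (\<lambda>A. A \<in> e p)}" if "open (Collect Q)" for Q
    unfolding spectrum_space_def using that
    by (auto simp: openin_pullback_topology intro!: exI[of _ "Collect Q"])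
  have "openin (topo X) (phi A)"
    using *[OF clopen_coordinate(1)] unfolding phi_def .
  moreover have "openin (topo X) {p \<in> S. \<not> A \<in> e p}"
    using *[of "\<lambda>c. \<not> c A"] open_Collect_neg[OF clopen_coordinate(2), of A] by simp
  moreover have "points X - phi A = {p \<in> S. \<not> A \<in> e p}" "phi A \<subseteq> points X"
    unfolding points_spectrum phi_def by auto
  moreover have "upset X (phi A)"
    unfolding upset_def up_def points_spectrum ord_spectrum phi_def by blast
  ultimately show ?thesis
    unfolding ClopUp_def clopen_def closedin_def by simp
qed

lemma Priestley_spectrum: "Priestley_space X"
  unfolding Priestley_space_def
proof (intro conjI ballI impI)
  have "inj_on e S" using e by (simp add: bij_betw_def)
  then show "partial_order_on (points X) (ord X)"
    unfolding partial_order_on_def preorder_on_def points_spectrum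
    by (auto simp: refl_on_def trans_def antisym_def ord_spectrum inj_on_def)
  have "(\<lambda>p A. A \<in> e p) ` S = (\<lambda>P A. A \<in> P) ` prime_filters Z"
    using e unfolding bij_betw_def by (metis image_image)
  then show "compact_space (topo X)"
    using compact_space_pullback[of "\<lambda>p A. A \<in> e p" S] compact_prime_filters[of Z]
    by (simp add: spectrum_space_def)
  fix p q assume "p \<in> points X" "q \<in> points X" "(p, q) \<notin> ord X"
  then obtain A where "p \<in> phi A" "q \<notin> phi A"
    unfolding ord_spectrum points_spectrum phi_def by blast
  then show "\<exists>U\<in>ClopUp X. p \<in> U \<and> q \<notin> U" using phi_ClopUp by blast
qed

lemma phi_open: "openin (topo X) (phi A)" and phi_closed: "closedin (topo X) (phi A)"
  using phi_ClopUp by (auto simp: ClopUp_def clopen_def)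

lemma phi_Int: "openin Z A \<Longrightarrow> openin Z B \<Longrightarrow> phi (A \<inter> B) = phi A \<inter> phi B"
  and phi_Un: "openin Z A \<Longrightarrow> openin Z B \<Longrightarrow> phi (A \<union> B) = phi A \<union> phi B"
  unfolding phi_def using e_Int e_Un by auto

text \<open>The neighbourhood filters are the prime filters given by the points of \<open>Z\<close>.\<close>

definition pt :: "'a \<Rightarrow> 'b" where
  "pt z = inv_into S e {A. openin Z A \<and> z \<in> A}"

lemma
  assumes "z \<in> topspace Z"
  shows pt_in: "pt z \<in> S" and e_pt: "A \<in> e (pt z) \<longleftrightarrow> openin Z A \<and> z \<in> A"
proof -
  have "{A. openin Z A \<and> z \<in> A} \<in> prime_filters Z"
    using assms unfolding prime_filters_def by auto
  then have *: "{A. openin Z A \<and> z \<in> A} \<in> e ` S" using e by (simp add: bij_betw_def)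
  show "pt z \<in> S" unfolding pt_def by (rule inv_into_into[OF *])
  have "e (pt z) = {A. openin Z A \<and> z \<in> A}" unfolding pt_def by (rule f_inv_into_f[OF *])
  then show "A \<in> e (pt z) \<longleftrightarrow> openin Z A \<and> z \<in> A" by simp
qed

lemma pt_phi: "z \<in> topspace Z \<Longrightarrow> openin Z A \<Longrightarrow> pt z \<in> phi A \<longleftrightarrow> z \<in> A"
  unfolding phi_def using pt_in e_pt by simp

text \<open>A point in \<open>A - B\<close> gives a neighbourhood filter in \<open>phi A - phi B\<close>; this takes the place of the
prime ideal theorem.\<close>

lemma phi_le_iff:
  assumes "openin Z A" "openin Z B"
  shows "phi A \<subseteq> phi B \<longleftrightarrow> A \<subseteq> B"
proof
  assume *: "phi A \<subseteq> phi B"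
  show "A \<subseteq> B"
  proof
    fix z assume z: "z \<in> A"
    then have "z \<in> topspace Z" using assms openin_subset by blast
    then show "z \<in> B" using pt_phi[of z A] pt_phi[of z B] assms * z by blast
  qed
next
  assume "A \<subseteq> B"
  then show "phi A \<subseteq> phi B" using e_mono assms(2) unfolding phi_def by blast
qed

lemma spectrum_basis:
  assumes W: "openin (topo X) W" "p \<in> W"
  obtains A B where "openin Z A" "openin Z B" "p \<in> phi A - phi B" "phi A - phi B \<subseteq> W"
proof -
  have p: "p \<in> S" using W openin_subset points_spectrum by blast
  define \<U> \<V> where "\<U> = phi ` e p" and "\<V> = phi ` {B. openin Z B \<and> B \<notin> e p}"
  obtain U V where UV: "U \<in> \<U>" "V \<in> \<V>" "(points X - W) \<inter> U \<subseteq> V"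
  proof (rule compact_separation[OF Priestley_compact[OF Priestley_spectrum], of "points X - W" \<U> \<V>])
    show "closedin (topo X) (points X - W)" using W(1) by blast
    show "\<U> \<noteq> {}" using e_top[OF p] unfolding \<U>_def by blast
    show "\<V> \<noteq> {}" using e_empty[OF p] openin_empty[of Z] unfolding \<V>_def by blast
    show "closedin (topo X) U" if "U \<in> \<U>" for U using that phi_closed unfolding \<U>_def by blast
    show "openin (topo X) U" if "U \<in> \<V>" for U using that phi_open unfolding \<V>_def by blast
    show "U \<inter> U' \<in> \<U>" if UU: "U \<in> \<U>" "U' \<in> \<U>" for U U'
    proof -
      obtain A A' where A: "A \<in> e p" "A' \<in> e p" "U = phi A" "U' = phi A'"
        using UU unfolding \<U>_def by blast
      note o = e_open[OF p A(1)] e_open[OF p A(2)]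
      show ?thesis unfolding \<U>_def A(3,4) phi_Int[OF o, symmetric]
        using e_Int[OF p o] A(1,2) by blast
    qed
    show "U \<union> U' \<in> \<V>" if UU: "U \<in> \<V>" "U' \<in> \<V>" for U U'
    proof -
      obtain A A' where A: "openin Z A" "A \<notin> e p" "openin Z A'" "A' \<notin> e p" "U = phi A" "U' = phi A'"
        using UU unfolding \<V>_def by blast
      show ?thesis unfolding \<V>_def A(5,6) phi_Un[OF A(1,3), symmetric]
        using e_Un[OF p A(1,3)] A(1-4) by blast
    qed
    show "(points X - W) \<inter> \<Inter>\<U> \<subseteq> \<Union>\<V>"
    proof
      fix q assume q: "q \<in> (points X - W) \<inter> \<Inter>\<U>"
      then have qS: "q \<in> S" and "q \<noteq> p" using W(2) points_spectrum by auto
      then have "e q \<noteq> e p" using e p unfolding bij_betw_def inj_on_def by blast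
      moreover have "e p \<subseteq> e q" using q unfolding \<U>_def phi_def by blast
      ultimately obtain B where "B \<in> e q" "B \<notin> e p" by blast
      then show "q \<in> \<Union>\<V>" using e_open[OF qS] qS unfolding \<V>_def phi_def by blast
    qed
  qed
  obtain A where A: "A \<in> e p" "U = phi A" using UV(1) unfolding \<U>_def by blast
  obtain B where B: "openin Z B" "B \<notin> e p" "V = phi B" using UV(2) unfolding \<V>_def by blast
  show ?thesis
  proof (rule that[OF e_open[OF p A(1)] B(1)])
    show "p \<in> phi A - phi B" using A B p unfolding phi_def by blast
    show "phi A - phi B \<subseteq> W" using UV(3) A(2) B(3) points_spectrum unfolding phi_def by blast
  qed
qed

text \<open>The intersection of the sets \<open>phi A\<close> with \<open>A \<in> e p\<close> is the up-closure of \<open>p\<close>, which is contained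
in \<open>W\<close>; compactness replaces the intersection by a single \<open>phi A\<close>.\<close>

lemma spectrum_upset_basis:
  assumes W: "openin (topo X) W" "upset X W" "p \<in> W"
  obtains A where "openin Z A" "p \<in> phi A" "phi A \<subseteq> W"
proof -
  have p: "p \<in> S" using W(1,3) openin_subset points_spectrum by blast
  define \<U> where "\<U> = phi ` e p"
  obtain U V where UV: "U \<in> \<U>" "V \<in> {{}}" "(points X - W) \<inter> U \<subseteq> (V :: 'b set)"
  proof (rule compact_separation[OF Priestley_compact[OF Priestley_spectrum], of "points X - W" \<U> "{{}}"])
    show "closedin (topo X) (points X - W)" using W(1) by blast
    show "\<U> \<noteq> {}" using e_top[OF p] unfolding \<U>_def by blast
    show "closedin (topo X) U" if "U \<in> \<U>" for U using that phi_closed unfolding \<U>_def by blast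
    show "U \<inter> U' \<in> \<U>" if UU: "U \<in> \<U>" "U' \<in> \<U>" for U U'
    proof -
      obtain A A' where A: "A \<in> e p" "A' \<in> e p" "U = phi A" "U' = phi A'"
        using UU unfolding \<U>_def by blast
      note o = e_open[OF p A(1)] e_open[OF p A(2)]
      show ?thesis unfolding \<U>_def A(3,4) phi_Int[OF o, symmetric]
        using e_Int[OF p o] A(1,2) by blast
    qed
    have "q \<in> W" if q: "q \<in> points X" "q \<in> \<Inter>\<U>" for q
    proof -
      have "e p \<subseteq> e q" using q(2) unfolding \<U>_def phi_def by blast
      then have "(p, q) \<in> ord X" using q(1) p unfolding ord_spectrum points_spectrum by blast
      then show ?thesis using W(2,3) unfolding upset_iff[OF Priestley_spectrum] by blast
    qed
    then show "(points X - W) \<inter> \<Inter>\<U> \<subseteq> \<Union>{{}}" by blast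
  qed auto
  obtain A where A: "A \<in> e p" "U = phi A" using UV(1) unfolding \<U>_def by blast
  show ?thesis
  proof (rule that[OF e_open[OF p A(1)]])
    show "p \<in> phi A" using A p unfolding phi_def by blast
    show "phi A \<subseteq> W" using UV(2,3) A(2) points_spectrum unfolding phi_def by blast
  qed
qed

text \<open>The prime filter theorem, by compactness: if no prime filter above \<open>e p\<close> contained \<open>A\<close> and
not \<open>B\<close>, then \<open>phi (C \<inter> A) \<subseteq> phi B\<close> for a single \<open>C \<in> e p\<close>, and so \<open>C \<inter> A \<subseteq> B\<close>.\<close>

lemma prime_filter_extension:
  assumes p: "p \<in> S" and A: "openin Z A" and B: "openin Z B"
    and imp: "\<And>C. C \<in> e p \<Longrightarrow> \<not> C \<inter> A \<subseteq> B"
  obtains q where "(p, q) \<in> ord X" "q \<in> phi A - phi B"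
proof (rule ccontr)
  assume "\<not> thesis"
  note * = that[THEN notE[OF this]]
  define \<U> where "\<U> = (\<lambda>C. phi (C \<inter> A)) ` e p"
  obtain U V where UV: "U \<in> \<U>" "V \<in> {phi B}" "points X \<inter> U \<subseteq> V"
  proof (rule compact_separation[OF Priestley_compact[OF Priestley_spectrum], of "points X" \<U> "{phi B}"])
    show "\<U> \<noteq> {}" using e_top[OF p] unfolding \<U>_def by blast
    show "closedin (topo X) U" if "U \<in> \<U>" for U using that phi_closed unfolding \<U>_def by blast
    show "openin (topo X) V" if "V \<in> {phi B}" for V using that phi_open by blast
    show "U \<inter> U' \<in> \<U>" if UU: "U \<in> \<U>" "U' \<in> \<U>" for U U'
    proof -
      obtain C C' where C: "C \<in> e p" "C' \<in> e p" "U = phi (C \<inter> A)" "U' = phi (C' \<inter> A)"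
        using UU unfolding \<U>_def by blast
      note o = e_open[OF p C(1)] e_open[OF p C(2)]
      have "U \<inter> U' = phi ((C \<inter> A) \<inter> (C' \<inter> A))"
        unfolding C(3,4) using o A by (subst phi_Int) auto
      moreover have "(C \<inter> A) \<inter> (C' \<inter> A) = (C \<inter> C') \<inter> A" by blast
      ultimately show ?thesis using e_Int[OF p o] C(1,2) unfolding \<U>_def by auto
    qed
    show "points X \<inter> \<Inter>\<U> \<subseteq> \<Union>{phi B}"
    proof
      fix q assume q: "q \<in> points X \<inter> \<Inter>\<U>"
      then have qS: "q \<in> S" by (simp add: points_spectrum)
      have CA: "C \<in> e q \<and> A \<in> e q" if C: "C \<in> e p" for C
      proof -
        have "C \<inter> A \<in> e q" using q C unfolding \<U>_def phi_def by blast
        then show ?thesis using e_Int[OF qS e_open[OF p C] A] by blast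
      qed
      then have "(p, q) \<in> ord X" using p qS unfolding ord_spectrum by blast
      moreover have "q \<in> phi A" using CA[OF e_top[OF p]] qS unfolding phi_def by blast
      ultimately show "q \<in> \<Union>{phi B}" using *[of q] by blast
    qed
  qed auto
  obtain C where C: "C \<in> e p" "U = phi (C \<inter> A)" using UV(1) unfolding \<U>_def by blast
  have "phi (C \<inter> A) \<subseteq> phi B" using UV(2,3) C(2) points_spectrum unfolding phi_def by blast
  then have "C \<inter> A \<subseteq> B" using phi_le_iff[of "C \<inter> A" B] e_open[OF p C(1)] A B by blast
  then show False using imp[OF C(1)] by blast
qed

text \<open>The Esakia property comes from Heyting implication: with \<open>D\<close> the implication from \<open>A\<close> to \<open>B\<close>, the
down-closure of the basic open set \<open>phi A - phi B\<close> is the complement of \<open>phi D\<close>.\<close>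

lemma openin_down_spectrum:
  assumes W: "openin (topo X) W"
  shows "openin (topo X) (down X W)"
proof (subst openin_subopen, intro ballI)
  fix p assume "p \<in> down X W"
  then obtain q where q: "p \<in> S" "q \<in> S" "q \<in> W" "e p \<subseteq> e q"
    unfolding down_def ord_spectrum by blast
  obtain A B where AB: "openin Z A" "openin Z B" "q \<in> phi A - phi B" "phi A - phi B \<subseteq> W"
    using spectrum_basis[OF W q(3)] .
  \<comment> \<open>The Heyting implication from A to B in the frame of opens of Z.\<close>
  define D where "D = \<Union>{C. openin Z C \<and> C \<inter> A \<subseteq> B}"
  have D: "openin Z D" "D \<inter> A \<subseteq> B" unfolding D_def by auto
  have "D \<notin> e p"
  proof
    assume "D \<in> e p"
    then have "D \<inter> A \<in> e q" using e_Int[OF q(2) D(1) AB(1)] q(4) AB(3) unfolding phi_def by blast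
    then have "B \<in> e q" using e_mono[OF q(2) _ D(2) AB(2)] by blast
    then show False using AB(3) q(2) unfolding phi_def by blast
  qed
  moreover have "p' \<in> down X W" if p': "p' \<in> S" "D \<notin> e p'" for p'
  proof -
    have "\<not> C \<inter> A \<subseteq> B" if C: "C \<in> e p'" for C
    proof
      assume "C \<inter> A \<subseteq> B"
      then have "C \<subseteq> D" using e_open[OF p'(1) C] unfolding D_def by blast
      then show False using e_mono[OF p'(1) C _ D(1)] p'(2) by blast
    qed
    then obtain q' where "(p', q') \<in> ord X" "q' \<in> phi A - phi B"
      using prime_filter_extension[OF p'(1) AB(1,2)] by blast
    then show ?thesis using AB(4) p'(1) unfolding down_def points_spectrum by blast
  qed
  moreover have "openin (topo X) (points X - phi D)" using phi_closed by (rule openin_diff[OF openin_topspace])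
  ultimately have "openin (topo X) (points X - phi D)" "p \<in> points X - phi D" "points X - phi D \<subseteq> down X W"
    using q(1) unfolding points_spectrum phi_def by blast+
  then show "\<exists>T. openin (topo X) T \<and> p \<in> T \<and> T \<subseteq> down X W" by blast
qed

lemma Esakia_spectrum: "Esakia_space X"
  unfolding Esakia_space_def clopen_def
  using Priestley_spectrum openin_down_spectrum closedin_down[OF Priestley_spectrum] by simp

text \<open>An open upset corresponds to an ideal of opens, and its closure to the union of this ideal:
if \<open>phi A - phi B\<close> meets \<open>phi D\<close>, then \<open>A \<inter> D - B\<close> has a point, and this point already
lies in a member of the ideal.\<close>

lemma closure_spectrum:
  assumes W: "openin (topo X) W" "upset X W"
  shows "topo X closure_of W = phi (\<Union>{A. openin Z A \<and> phi A \<subseteq> W})"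
proof
  let ?D = "\<Union>{A. openin Z A \<and> phi A \<subseteq> W}"
  have D: "openin Z ?D" by auto
  have "W \<subseteq> phi ?D"
  proof
    fix p assume "p \<in> W"
    then obtain A where A: "openin Z A" "p \<in> phi A" "phi A \<subseteq> W"
      using spectrum_upset_basis[OF W] by blast
    then have "A \<subseteq> ?D" by blast
    then show "p \<in> phi ?D" using phi_le_iff[OF A(1) D] A(2) by blast
  qed
  then show "topo X closure_of W \<subseteq> phi ?D" using phi_closed closure_of_minimal by blast
  show "phi ?D \<subseteq> topo X closure_of W"
  proof
    fix p assume p: "p \<in> phi ?D"
    have "\<exists>y. y \<in> W \<and> y \<in> T" if T: "p \<in> T" "openin (topo X) T" for T
    proof -
      obtain A B where AB: "openin Z A" "openin Z B" "p \<in> phi A - phi B" "phi A - phi B \<subseteq> T"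
        using spectrum_basis[OF T(2,1)] .
      have "p \<in> phi (A \<inter> ?D)" using phi_Int[OF AB(1) D] p AB(3) by blast
      then have "\<not> phi (A \<inter> ?D) \<subseteq> phi B" using AB(3) by blast
      then have "\<not> A \<inter> ?D \<subseteq> B"
        using phi_le_iff[OF openin_Int[OF AB(1) D] AB(2)] by simp
      then obtain z C where z: "z \<in> A" "z \<notin> B" "z \<in> C" "openin Z C" "phi C \<subseteq> W" by blast
      then have "z \<in> topspace Z" using openin_subset by blast
      then have "pt z \<in> phi A - phi B" "pt z \<in> phi C" using pt_phi AB(1,2) z by auto
      then show ?thesis using AB(4) z(5) by blast
    qed
    moreover have "p \<in> points X" using p unfolding phi_def points_spectrum by blast
    ultimately show "p \<in> topo X closure_of W" unfolding in_closure_of by blast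
  qed
qed

lemma L_space_spectrum: "L_space X"
  unfolding L_space_def using Esakia_spectrum closure_spectrum phi_open by simp

end

locale compact_Hausdorff_spectrum = spectrum +
  assumes comp: "compact_space Z" and haus: "Hausdorff_space Z"
begin

text \<open>If no neighbourhood filter were contained in \<open>e p\<close>, then \<open>Z\<close> would be covered by opens not in
\<open>e p\<close>; by compactness finitely many of them cover \<open>Z\<close>, against primeness.\<close>

lemma above_pt:
  assumes p: "p \<in> S"
  obtains z where "z \<in> topspace Z" "(pt z, p) \<in> ord X"
proof (rule ccontr)
  assume "\<not> thesis"
  note * = that[THEN notE[OF this]]
  have "\<exists>A. openin Z A \<and> z \<in> A \<and> A \<notin> e p" if z: "z \<in> topspace Z" for z
  proof -
    have "(pt z, p) \<notin> ord X" using *[OF z] by blast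
    then show ?thesis using pt_in[OF z] p e_pt[OF z] unfolding ord_spectrum by blast
  qed
  then have "topspace Z \<subseteq> \<Union>{A. openin Z A \<and> A \<notin> e p}" by blast
  then obtain \<F> where \<F>: "finite \<F>" "\<F> \<subseteq> {A. openin Z A \<and> A \<notin> e p}" "topspace Z \<subseteq> \<Union>\<F>"
    using comp unfolding compact_space_alt by (metis (no_types, lifting) mem_Collect_eq)
  from \<F>(1,2) have "openin Z (\<Union>\<F>) \<and> \<Union>\<F> \<notin> e p"
  proof (induction \<F>)
    case empty
    then show ?case using e_empty[OF p] by simp
  next
    case (insert A \<F>)
    then have "openin Z A" "A \<notin> e p" "openin Z (\<Union>\<F>)" "\<Union>\<F> \<notin> e p" by auto
    then show ?case using e_Un[OF p, of A "\<Union>\<F>"] openin_Un[of Z A "\<Union>\<F>"] by simp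
  qed
  then show False using e_mono[OF p e_top[OF p] \<F>(3)] by blast
qed

lemma closed_point: 
  assumes "z \<in> topspace Z" shows "openin Z (topspace Z - {z})"
  using closedin_Hausdorff_sing_eq[OF haus] assms by blast

text \<open>As points of \<open>Z\<close> are closed, a filter of opens lies inside the neighbourhood filter of \<open>z\<close> exactly
if it omits the complement of \<open>z\<close>.\<close>

lemma down_pt:
  assumes z: "z \<in> topspace Z"
  shows "down X {pt z} = points X - phi (topspace Z - {z})"
proof -
  have "e p \<subseteq> e (pt z) \<longleftrightarrow> topspace Z - {z} \<notin> e p" if p: "p \<in> S" for p
  proof
    show "topspace Z - {z} \<notin> e p" if "e p \<subseteq> e (pt z)"
      using that e_pt[OF z, of "topspace Z - {z}"] by blast
    show "e p \<subseteq> e (pt z)" if n: "topspace Z - {z} \<notin> e p"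
    proof
      fix A assume A: "A \<in> e p"
      have o: "openin Z A" using e_open[OF p A] .
      have "z \<in> A"
      proof (rule ccontr)
        assume "z \<notin> A"
        then have "A \<subseteq> topspace Z - {z}" using openin_subset[OF o] by blast
        then show False using e_mono[OF p A _ closed_point[OF z]] n by blast
      qed
      then show "A \<in> e (pt z)" using e_pt[OF z] o by blast
    qed
  qed
  then show ?thesis
    using pt_in[OF z] unfolding down_def points_spectrum ord_spectrum phi_def by blast
qed

lemma pt_localic:
  assumes z: "z \<in> topspace Z" shows "pt z \<in> localic_part X"
proof -
  have "clopen X (points X - phi (topspace Z - {z}))"
    using phi_open phi_closed unfolding clopen_def by (auto intro: closedin_diff openin_diff)
  then show ?thesis
    using pt_in[OF z] by (simp add: localic_part_def down_pt[OF z] points_spectrum)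
qed

lemma L_compact_spectrum: "L_compact X"
  unfolding L_compact_def Scott_upset_def
proof (intro conjI)
  show "upset X (points X)" using upset_points[OF Priestley_spectrum] .
  show "min_elems X (points X) \<subseteq> localic_part X"
  proof
    fix p assume p: "p \<in> min_elems X (points X)"
    then have "p \<in> S" unfolding min_elems_def points_spectrum by blast
    then obtain z where z: "z \<in> topspace Z" "(pt z, p) \<in> ord X" using above_pt by blast
    then have "pt z = p" using p pt_in[OF z(1)] unfolding min_elems_def points_spectrum by blast
    then show "p \<in> localic_part X" using pt_localic[OF z(1)] by simp
  qed
qed simp

text \<open>Every basic open subset of \<open>U\<close> contains a neighbourhood filter \<open>pt z\<close>, and \<open>pt z\<close> lies in
\<open>phi C \<subseteq> U\<close> for some neighbourhood \<open>C\<close> of \<open>z\<close>. By regularity of \<open>Z\<close>, some neighbourhood \<open>D\<close> of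
\<open>z\<close> has its closure inside \<open>C\<close>, which makes \<open>phi D\<close> well inside \<open>phi C\<close>.\<close>

lemma L_regular_spectrum: "L_regular X"
  unfolding L_regular_def
proof (intro ballI subsetI)
  fix U p assume U: "U \<in> ClopUp X" and p: "p \<in> U"
  have Uo: "openin (topo X) U" "upset X U" using U ClopUp_iff[OF Priestley_spectrum] by auto
  have "\<exists>y. y \<in> reg X U \<and> y \<in> T" if T: "p \<in> T" "openin (topo X) T" for T
  proof -
    have "openin (topo X) (T \<inter> U)" "p \<in> T \<inter> U" using T Uo p by auto
    then obtain A B where AB: "openin Z A" "openin Z B" "p \<in> phi A - phi B" "phi A - phi B \<subseteq> T \<inter> U"
      using spectrum_basis by blast
    then obtain z where z: "z \<in> A" "z \<notin> B" using phi_le_iff[OF AB(1,2)] by blast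
    have zZ: "z \<in> topspace Z" using z(1) AB(1) openin_subset by blast
    have ptU: "pt z \<in> T \<inter> U" using AB(4) pt_phi[OF zZ AB(1)] pt_phi[OF zZ AB(2)] z by blast
    then obtain C where C: "openin Z C" "pt z \<in> phi C" "phi C \<subseteq> U"
      using spectrum_upset_basis[OF Uo] by blast
    have zC: "z \<in> C" using pt_phi[OF zZ C(1)] C(2) by blast
    have "regular_space Z" using compact_Hausdorff_imp_regular_space[OF comp haus] .
    then obtain D K where DK: "openin Z D" "closedin Z K" "z \<in> D" "D \<subseteq> K" "K \<subseteq> C"
      using C(1) zC unfolding neighbourhood_base_of_closedin[symmetric] neighbourhood_base_of by metis
    have "down X (phi D) \<subseteq> phi C"
    proof
      fix r assume "r \<in> down X (phi D)"
      then obtain q where q: "r \<in> S" "q \<in> S" "e r \<subseteq> e q" "D \<in> e q"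
        unfolding down_def ord_spectrum phi_def by blast
      have o: "openin Z (topspace Z - K)" using DK(2) by blast
      have "D \<inter> (topspace Z - K) = {}" using DK(4) by blast
      then have "topspace Z - K \<notin> e q" using e_Int[OF q(2) DK(1) o] e_empty[OF q(2)] q(4) by auto
      moreover have "C \<union> (topspace Z - K) = topspace Z" using DK(5) openin_subset[OF C(1)] by blast
      then have "C \<in> e r \<or> topspace Z - K \<in> e r" using e_Un[OF q(1) C(1) o] e_top[OF q(1)] by simp
      ultimately show "r \<in> phi C" using q(1,3) unfolding phi_def by blast
    qed
    then have "phi D \<subseteq> reg X U" using C(3) phi_ClopUp unfolding reg_def well_inside_def by blast
    then show ?thesis using pt_phi[OF zZ DK(1)] DK(3) ptU by blast
  qed
  moreover have "p \<in> points X" using p ClopUp_subset[OF Priestley_spectrum U] by blast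
  ultimately show "p \<in> topo X closure_of reg X U" unfolding in_closure_of by blast
qed

lemma KRL_spectrum: "KRL_space X"
  unfolding KRL_space_def using L_space_spectrum L_compact_spectrum L_regular_spectrum by blast

lemma Loc_spectrum_homeomorphic: "Loc X homeomorphic_space Z"
proof -
  have inj: "inj_on pt (topspace Z)"
  proof (rule inj_onI)
    fix z w assume z: "z \<in> topspace Z" and w: "w \<in> topspace Z" and eq: "pt z = pt w"
    have "topspace Z - {z} \<notin> e (pt w)" using e_pt[OF z] eq by simp
    then show "z = w" using e_pt[OF w] closed_point[OF z] w by blast
  qed
  have im: "pt ` topspace Z = localic_part X"
  proof
    show "pt ` topspace Z \<subseteq> localic_part X" using pt_localic by blast
    show "localic_part X \<subseteq> pt ` topspace Z"
    proof
      fix y assume y: "y \<in> localic_part X"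
      then have "y \<in> S" using localic_points[OF y] points_spectrum by simp
      then obtain z where "z \<in> topspace Z" "(pt z, y) \<in> ord X" using above_pt by blast
      then show "y \<in> pt ` topspace Z" using localic_minimal[OF KRL_spectrum y] by blast
    qed
  qed
  have "homeomorphic_map Z (Loc X) pt"
  proof (rule bijective_open_imp_homeomorphic_map[OF _ _ _ inj])
    show "pt ` topspace Z = topspace (Loc X)" using im topspace_Loc[OF Priestley_spectrum] by simp
    show "continuous_map Z (Loc X) pt"
      unfolding continuous_map_def
    proof (intro conjI allI impI)
      show "pt \<in> topspace Z \<rightarrow> topspace (Loc X)" using im topspace_Loc[OF Priestley_spectrum] by blast
      fix T assume "openin (Loc X) T"
      then obtain W where W: "openin (topo X) W" "upset X W" "T = W \<inter> localic_part X"
        using openin_Loc[OF Priestley_spectrum] by blast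
      show "openin Z {z \<in> topspace Z. pt z \<in> T}"
      proof (subst openin_subopen, intro ballI)
        fix z assume "z \<in> {z \<in> topspace Z. pt z \<in> T}"
        then have z: "z \<in> topspace Z" "pt z \<in> W" using W(3) by auto
        obtain A where A: "openin Z A" "pt z \<in> phi A" "phi A \<subseteq> W" using spectrum_upset_basis[OF W(1,2) z(2)] .
        have "A \<subseteq> {z \<in> topspace Z. pt z \<in> T}"
        proof
          fix w assume w: "w \<in> A"
          then have wZ: "w \<in> topspace Z" using openin_subset[OF A(1)] by blast
          then have "pt w \<in> W" using pt_phi[OF wZ A(1)] w A(3) by blast
          then show "w \<in> {z \<in> topspace Z. pt z \<in> T}" using wZ pt_localic[OF wZ] W(3) by blast
        qed
        then show "\<exists>A. openin Z A \<and> z \<in> A \<and> A \<subseteq> {z \<in> topspace Z. pt z \<in> T}"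
          using A(1) pt_phi[OF z(1) A(1)] A(2) by blast
      qed
    qed
    show "open_map Z (Loc X) pt"
      unfolding open_map_def
    proof (intro allI impI)
      fix A assume A: "openin Z A"
      have "pt ` A = phi A \<inter> localic_part X"
      proof
        show "pt ` A \<subseteq> phi A \<inter> localic_part X"
          using pt_phi[OF _ A] openin_subset[OF A] pt_localic by blast
        show "phi A \<inter> localic_part X \<subseteq> pt ` A"
          using pt_phi[OF _ A] unfolding im[symmetric] by blast
      qed
      then show "openin (Loc X) (pt ` A)"
        using phi_ClopUp[of A] unfolding openin_Loc[OF Priestley_spectrum] ClopUp_iff[OF Priestley_spectrum]
        by blast
    qed
  qed
  then show ?thesis
    using homeomorphic_space homeomorphic_space_sym by blast
qed

end

section \<open>Fully faithful, essentially surjective functors\<close>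

lemma
  assumes "is_category C"
  shows category_Idt: "x \<in> Ob C \<Longrightarrow> Idt C x \<in> Hom C x x"
    and category_Comp: "x \<in> Ob C \<Longrightarrow> y \<in> Ob C \<Longrightarrow> z \<in> Ob C \<Longrightarrow>
      f \<in> Hom C x y \<Longrightarrow> g \<in> Hom C y z \<Longrightarrow> Comp C x y z g f \<in> Hom C x z"
    and category_Idt_right: "x \<in> Ob C \<Longrightarrow> y \<in> Ob C \<Longrightarrow> f \<in> Hom C x y \<Longrightarrow>
      Comp C x x y f (Idt C x) = f"
    and category_Idt_left: "x \<in> Ob C \<Longrightarrow> y \<in> Ob C \<Longrightarrow> f \<in> Hom C x y \<Longrightarrow>
      Comp C x y y (Idt C y) f = f"
    and category_assoc: "w \<in> Ob C \<Longrightarrow> x \<in> Ob C \<Longrightarrow> y \<in> Ob C \<Longrightarrow> z \<in> Ob C \<Longrightarrow>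
      f \<in> Hom C w x \<Longrightarrow> g \<in> Hom C x y \<Longrightarrow> h \<in> Hom C y z \<Longrightarrow>
      Comp C w y z h (Comp C w x y g f) = Comp C w x z (Comp C x y z h g) f"
  using assms unfolding is_category_def by blast+

text \<open>Choose for each \<open>z\<close> an object \<open>Go z\<close> and an isomorphism \<open>\<epsilon> z\<close> from \<open>Fo (Go z)\<close> to \<open>z\<close> with inverse
\<open>\<delta> z\<close>. The quasi-inverse functor sends \<open>h\<close> to the unique lift of the conjugate \<open>K\<close> of \<open>h\<close> by
these isomorphisms, and the unit at \<open>x\<close> is the unique lift of \<open>\<delta> (Fo x)\<close>.\<close>

theorem equivalence_if_fully_faithful_ess_surj:
  assumes C: "is_category C" and D: "is_category D" and F: "is_functor C D Fo Fa"
    and ff: "\<And>x y. x \<in> Ob C \<Longrightarrow> y \<in> Ob C \<Longrightarrow> bij_betw (Fa x y) (Hom C x y) (Hom D (Fo x) (Fo y))"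
    and es: "\<And>z. z \<in> Ob D \<Longrightarrow> \<exists>x\<in>Ob C. \<exists>i. is_iso D (Fo x) z i"
  shows "equivalent_categories C D"
proof -
  have FoD: "Fo x \<in> Ob D" if "x \<in> Ob C" for x
    using F that unfolding is_functor_def by blast
  have FaD: "Fa x y f \<in> Hom D (Fo x) (Fo y)" if "x \<in> Ob C" "y \<in> Ob C" "f \<in> Hom C x y" for x y f
    using F that unfolding is_functor_def by blast
  have FaI: "Fa x x (Idt C x) = Idt D (Fo x)" if "x \<in> Ob C" for x
    using F that unfolding is_functor_def by blast
  have FaC: "Fa x z (Comp C x y z g f) = Comp D (Fo x) (Fo y) (Fo z) (Fa y z g) (Fa x y f)"
    if "x \<in> Ob C" "y \<in> Ob C" "z \<in> Ob C" "f \<in> Hom C x y" "g \<in> Hom C y z" for x y z f g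
    using F that unfolding is_functor_def by blast
  define L where "L x y = inv_into (Hom C x y) (Fa x y)" for x y
  have L: "L x y h \<in> Hom C x y" "Fa x y (L x y h) = h"
    if "x \<in> Ob C" "y \<in> Ob C" "h \<in> Hom D (Fo x) (Fo y)" for x y h
    using ff[OF that(1,2)] that(3) unfolding L_def bij_betw_def
    by (auto intro: inv_into_into f_inv_into_f)
  have Fa_inj: "f = g"
    if "x \<in> Ob C" "y \<in> Ob C" "f \<in> Hom C x y" "g \<in> Hom C x y" "Fa x y f = Fa x y g" for x y f g
    using ff[OF that(1,2)] that(3-5) unfolding bij_betw_def inj_on_def by blast
  obtain Go where Go: "\<And>z. z \<in> Ob D \<Longrightarrow> Go z \<in> Ob C"
    and "\<And>z. z \<in> Ob D \<Longrightarrow> \<exists>i. is_iso D (Fo (Go z)) z i"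
    using es by metis
  then have "\<exists>i j. i \<in> Hom D (Fo (Go z)) z \<and> j \<in> Hom D z (Fo (Go z)) \<and>
      Comp D (Fo (Go z)) z (Fo (Go z)) j i = Idt D (Fo (Go z)) \<and>
      Comp D z (Fo (Go z)) z i j = Idt D z" if "z \<in> Ob D" for z
    using that unfolding is_iso_def by blast
  then obtain \<epsilon> \<delta> where \<epsilon>: "\<And>z. z \<in> Ob D \<Longrightarrow> \<epsilon> z \<in> Hom D (Fo (Go z)) z"
    and \<delta>: "\<And>z. z \<in> Ob D \<Longrightarrow> \<delta> z \<in> Hom D z (Fo (Go z))"
    and \<delta>\<epsilon>: "\<And>z. z \<in> Ob D \<Longrightarrow> Comp D (Fo (Go z)) z (Fo (Go z)) (\<delta> z) (\<epsilon> z) = Idt D (Fo (Go z))"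
    and \<epsilon>\<delta>: "\<And>z. z \<in> Ob D \<Longrightarrow> Comp D z (Fo (Go z)) z (\<epsilon> z) (\<delta> z) = Idt D z"
    by metis
  note FG = FoD[OF Go]
  define K where "K z w h = Comp D (Fo (Go z)) w (Fo (Go w)) (\<delta> w) (Comp D (Fo (Go z)) z w h (\<epsilon> z))" for z w h
  define Ga where "Ga z w h = L (Go z) (Go w) (K z w h)" for z w h
  have h\<epsilon>: "Comp D (Fo (Go z)) z w h (\<epsilon> z) \<in> Hom D (Fo (Go z)) w"
    if "z \<in> Ob D" "w \<in> Ob D" "h \<in> Hom D z w" for z w h
    using category_Comp[OF D FG[OF that(1)] that(1,2) \<epsilon>[OF that(1)] that(3)] .
  have K: "K z w h \<in> Hom D (Fo (Go z)) (Fo (Go w))"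
    if "z \<in> Ob D" "w \<in> Ob D" "h \<in> Hom D z w" for z w h
    unfolding K_def
    using category_Comp[OF D FG[OF that(1)] that(2) FG[OF that(2)] h\<epsilon>[OF that] \<delta>[OF that(2)]] .
  have cancel: "Comp D x (Fo (Go w)) w (\<epsilon> w) (Comp D x w (Fo (Go w)) (\<delta> w) k) = k"
    if "x \<in> Ob D" "w \<in> Ob D" "k \<in> Hom D x w" for x w k
    using category_assoc[OF D that(1,2) FG[OF that(2)] that(2,3) \<delta>[OF that(2)] \<epsilon>[OF that(2)]]
      \<epsilon>\<delta>[OF that(2)] category_Idt_left[OF D that] by simp
  have K_Idt: "K z z (Idt D z) = Idt D (Fo (Go z))" if z: "z \<in> Ob D" for z
    unfolding K_def using category_Idt_left[OF D FG[OF z] z \<epsilon>[OF z]] \<delta>\<epsilon>[OF z] by simp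
  have K_Comp: "K z v (Comp D z w v g h) =
      Comp D (Fo (Go z)) (Fo (Go w)) (Fo (Go v)) (K w v g) (K z w h)"
    if z: "z \<in> Ob D" and w: "w \<in> Ob D" and v: "v \<in> Ob D" and h: "h \<in> Hom D z w" and g: "g \<in> Hom D w v"
    for z w v g h
  proof -
    let ?z = "Fo (Go z)" and ?w = "Fo (Go w)" and ?v = "Fo (Go v)"
    let ?k = "Comp D ?z z w h (\<epsilon> z)"
    have "Comp D ?z ?w ?v (K w v g) (K z w h) =
        Comp D ?z v ?v (\<delta> v) (Comp D ?z ?w v (Comp D ?w w v g (\<epsilon> w)) (K z w h))"
      unfolding K_def[of w v g]
      using category_assoc[OF D FG[OF z] FG[OF w] v FG[OF v] K[OF z w h] h\<epsilon>[OF w v g] \<delta>[OF v]] by simp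
    also have "Comp D ?z ?w v (Comp D ?w w v g (\<epsilon> w)) (K z w h) =
        Comp D ?z w v g (Comp D ?z ?w w (\<epsilon> w) (K z w h))"
      using category_assoc[OF D FG[OF z] FG[OF w] w v K[OF z w h] \<epsilon>[OF w] g] by simp
    also have "Comp D ?z ?w w (\<epsilon> w) (K z w h) = ?k"
      unfolding K_def using cancel[OF FG[OF z] w h\<epsilon>[OF z w h]] .
    also have "Comp D ?z w v g ?k = Comp D ?z z v (Comp D z w v g h) (\<epsilon> z)"
      using category_assoc[OF D FG[OF z] z w v \<epsilon>[OF z] h g] .
    finally show ?thesis unfolding K_def[of z v] by simp
  qed
  have Ga: "Ga z w h \<in> Hom C (Go z) (Go w)" "Fa (Go z) (Go w) (Ga z w h) = K z w h"
    if "z \<in> Ob D" "w \<in> Ob D" "h \<in> Hom D z w" for z w h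
    unfolding Ga_def using L[OF Go[OF that(1)] Go[OF that(2)] K[OF that]] by auto
  have G: "is_functor D C Go Ga"
    unfolding is_functor_def
  proof (intro conjI ballI)
    fix z assume z: "z \<in> Ob D"
    show "Go z \<in> Ob C" using Go[OF z] .
    show "Ga z z (Idt D z) = Idt C (Go z)"
      using Ga[OF z z category_Idt[OF D z]] K_Idt[OF z] FaI[OF Go[OF z]] category_Idt[OF C Go[OF z]]
      by (intro Fa_inj[OF Go[OF z] Go[OF z]]) auto
    fix w assume w: "w \<in> Ob D"
    show "Ga z w h \<in> Hom C (Go z) (Go w)" if "h \<in> Hom D z w" for h using Ga(1)[OF z w that] .
    fix v h g assume v: "v \<in> Ob D" and h: "h \<in> Hom D z w" and g: "g \<in> Hom D w v"
    note gh = category_Comp[OF D z w v h g]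
    show "Ga z v (Comp D z w v g h) = Comp C (Go z) (Go w) (Go v) (Ga w v g) (Ga z w h)"
    proof (rule Fa_inj[OF Go[OF z] Go[OF v] Ga(1)[OF z v gh]])
      show "Comp C (Go z) (Go w) (Go v) (Ga w v g) (Ga z w h) \<in> Hom C (Go z) (Go v)"
        using category_Comp[OF C Go[OF z] Go[OF w] Go[OF v] Ga(1)[OF z w h] Ga(1)[OF w v g]] .
      show "Fa (Go z) (Go v) (Ga z v (Comp D z w v g h)) =
          Fa (Go z) (Go v) (Comp C (Go z) (Go w) (Go v) (Ga w v g) (Ga z w h))"
        unfolding Ga(2)[OF z v gh] K_Comp[OF z w v h g]
          FaC[OF Go[OF z] Go[OF w] Go[OF v] Ga(1)[OF z w h] Ga(1)[OF w v g]]
          Ga(2)[OF z w h] Ga(2)[OF w v g] ..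
    qed
  qed
  have counit: "natural_iso D D (\<lambda>x. Fo (Go x)) (\<lambda>x y f. Fa (Go x) (Go y) (Ga x y f)) (\<lambda>x. x) (\<lambda>x y f. f) \<epsilon>"
    unfolding natural_iso_def is_iso_def
  proof (intro conjI ballI)
    fix z assume z: "z \<in> Ob D"
    show "\<epsilon> z \<in> Hom D (Fo (Go z)) z" using \<epsilon>[OF z] .
    show "\<exists>g\<in>Hom D z (Fo (Go z)). Comp D (Fo (Go z)) z (Fo (Go z)) g (\<epsilon> z) = Idt D (Fo (Go z)) \<and>
        Comp D z (Fo (Go z)) z (\<epsilon> z) g = Idt D z"
      using \<delta>[OF z] \<delta>\<epsilon>[OF z] \<epsilon>\<delta>[OF z] by blast
    fix w h assume w: "w \<in> Ob D" and h: "h \<in> Hom D z w"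
    show "Comp D (Fo (Go z)) (Fo (Go w)) w (\<epsilon> w) (Fa (Go z) (Go w) (Ga z w h)) =
        Comp D (Fo (Go z)) z w h (\<epsilon> z)"
      unfolding Ga(2)[OF z w h] K_def using cancel[OF FG[OF z] w h\<epsilon>[OF z w h]] .
  qed
  define \<eta> where "\<eta> x = L x (Go (Fo x)) (\<delta> (Fo x))" for x
  define \<theta> where "\<theta> x = L (Go (Fo x)) x (\<epsilon> (Fo x))" for x
  have GF: "Go (Fo x) \<in> Ob C" if "x \<in> Ob C" for x using Go[OF FoD[OF that]] .
  have \<eta>: "\<eta> x \<in> Hom C x (Go (Fo x))" "Fa x (Go (Fo x)) (\<eta> x) = \<delta> (Fo x)" if "x \<in> Ob C" for x
    unfolding \<eta>_def using L[OF that GF[OF that] \<delta>[OF FoD[OF that]]] by auto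
  have \<theta>: "\<theta> x \<in> Hom C (Go (Fo x)) x" "Fa (Go (Fo x)) x (\<theta> x) = \<epsilon> (Fo x)" if "x \<in> Ob C" for x
    unfolding \<theta>_def using L[OF GF[OF that] that \<epsilon>[OF FoD[OF that]]] by auto
  have unit: "natural_iso C C (\<lambda>x. x) (\<lambda>x y f. f) (\<lambda>x. Go (Fo x)) (\<lambda>x y f. Ga (Fo x) (Fo y) (Fa x y f)) \<eta>"
    unfolding natural_iso_def is_iso_def
  proof (intro conjI ballI)
    fix x assume x: "x \<in> Ob C"
    let ?x = "Go (Fo x)"
    show "\<eta> x \<in> Hom C x ?x" using \<eta>(1)[OF x] .
    have "Comp C x ?x x (\<theta> x) (\<eta> x) = Idt C x"
    proof (rule Fa_inj[OF x x category_Comp[OF C x GF[OF x] x \<eta>(1)[OF x] \<theta>(1)[OF x]] category_Idt[OF C x]])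
      show "Fa x x (Comp C x ?x x (\<theta> x) (\<eta> x)) = Fa x x (Idt C x)"
        unfolding FaC[OF x GF[OF x] x \<eta>(1)[OF x] \<theta>(1)[OF x]] \<eta>(2)[OF x] \<theta>(2)[OF x] FaI[OF x]
        using \<epsilon>\<delta>[OF FoD[OF x]] .
    qed
    moreover have "Comp C ?x x ?x (\<eta> x) (\<theta> x) = Idt C ?x"
    proof (rule Fa_inj[OF GF[OF x] GF[OF x] category_Comp[OF C GF[OF x] x GF[OF x] \<theta>(1)[OF x] \<eta>(1)[OF x]]
          category_Idt[OF C GF[OF x]]])
      show "Fa ?x ?x (Comp C ?x x ?x (\<eta> x) (\<theta> x)) = Fa ?x ?x (Idt C ?x)"
        unfolding FaC[OF GF[OF x] x GF[OF x] \<theta>(1)[OF x] \<eta>(1)[OF x]] \<eta>(2)[OF x] \<theta>(2)[OF x] FaI[OF GF[OF x]]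
        using \<delta>\<epsilon>[OF FoD[OF x]] .
    qed
    ultimately show "\<exists>g\<in>Hom C ?x x. Comp C x ?x x g (\<eta> x) = Idt C x \<and> Comp C ?x x ?x (\<eta> x) g = Idt C ?x"
      using \<theta>(1)[OF x] by blast
    fix y f assume y: "y \<in> Ob C" and f: "f \<in> Hom C x y"
    let ?y = "Go (Fo y)"
    note Ff = FaD[OF x y f] and Fx = FoD[OF x] and Fy = FoD[OF y]
    note Gf = Ga[OF Fx Fy Ff]
    show "Comp C x y ?y (\<eta> y) f = Comp C x ?x ?y (Ga (Fo x) (Fo y) (Fa x y f)) (\<eta> x)"
    proof (rule Fa_inj[OF x GF[OF y] category_Comp[OF C x y GF[OF y] f \<eta>(1)[OF y]]
          category_Comp[OF C x GF[OF x] GF[OF y] \<eta>(1)[OF x] Gf(1)]])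
      have "Comp D (Fo x) (Fo ?x) (Fo ?y) (K (Fo x) (Fo y) (Fa x y f)) (\<delta> (Fo x)) =
          Comp D (Fo x) (Fo y) (Fo ?y) (\<delta> (Fo y))
            (Comp D (Fo x) (Fo ?x) (Fo y) (Comp D (Fo ?x) (Fo x) (Fo y) (Fa x y f) (\<epsilon> (Fo x))) (\<delta> (Fo x)))"
        unfolding K_def
        using category_assoc[OF D Fx FG[OF Fx] Fy FG[OF Fy] \<delta>[OF Fx] h\<epsilon>[OF Fx Fy Ff] \<delta>[OF Fy]] by simp
      also have "Comp D (Fo x) (Fo ?x) (Fo y) (Comp D (Fo ?x) (Fo x) (Fo y) (Fa x y f) (\<epsilon> (Fo x))) (\<delta> (Fo x)) =
          Fa x y f"
        using category_assoc[OF D Fx FG[OF Fx] Fx Fy \<delta>[OF Fx] \<epsilon>[OF Fx] Ff] \<epsilon>\<delta>[OF Fx]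
          category_Idt_right[OF D Fx Fy Ff] by simp
      finally show "Fa x ?y (Comp C x y ?y (\<eta> y) f) =
          Fa x ?y (Comp C x ?x ?y (Ga (Fo x) (Fo y) (Fa x y f)) (\<eta> x))"
        unfolding FaC[OF x y GF[OF y] f \<eta>(1)[OF y]] FaC[OF x GF[OF x] GF[OF y] \<eta>(1)[OF x] Gf(1)]
          \<eta>(2)[OF x] \<eta>(2)[OF y] Gf(2) by simp
    qed
  qed
  show ?thesis
    unfolding equivalent_categories_def
    by (rule conjI[OF C conjI[OF D]], rule exI[of _ Fo], rule exI[of _ Fa], rule exI[of _ Go],
        rule exI[of _ Ga], rule exI[of _ \<eta>], rule exI[of _ \<epsilon>],
        rule conjI[OF F conjI[OF G conjI[OF unit counit]]])
qed

section \<open>The equivalence\<close>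

lemma L_morphism_cong:
  assumes "Priestley_space X1" "L_morphism X1 X2 f" "\<And>x. x \<in> points X1 \<Longrightarrow> f x = g x"
  shows "L_morphism X1 X2 g"
proof -
  have "{x \<in> points X1. g x \<in> U} = {x \<in> points X1. f x \<in> U}" for U
    using assms(3) by auto
  moreover have "continuous_map (topo X1) (topo X2) g"
    using assms(2,3) continuous_map_eq[of "topo X1" "topo X2" f g]
    unfolding L_morphism_def by blast
  moreover have "(g x, g y) \<in> ord X2" if "(x, y) \<in> ord X1" for x y
    using assms(2) that assms(3)[of x] assms(3)[of y] ord_in_points[OF assms(1) that]
    unfolding L_morphism_def by metis
  ultimately show ?thesis using assms(2) unfolding L_morphism_def by auto
qed

lemma L_morphism_id: "L_morphism X X (\<lambda>x. x)"
proof -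
  have "{x \<in> points X. x \<in> topo X closure_of U} = topo X closure_of {x \<in> points X. x \<in> U}" for U
    using closure_of_restrict[of "topo X" U] closure_of_subset_topspace[of "topo X" U]
    by (auto simp: Int_def)
  then show ?thesis unfolding L_morphism_def by auto
qed

lemma L_morphism_compose:
  assumes K1: "KRL_space X1" and K2: "KRL_space X2"
    and f: "L_morphism X1 X2 f" and g: "L_morphism X2 X3 g"
  shows "L_morphism X1 X3 (compose (points X1) g f)"
proof (rule L_morphism_cong[OF KRL_Priestley[OF K1], of X3 "g \<circ> f"])
  have "{x \<in> points X1. (g \<circ> f) x \<in> topo X3 closure_of U} =
      topo X1 closure_of {x \<in> points X1. (g \<circ> f) x \<in> U}" if U: "openin (topo X3) U" "upset X3 U" for U
  proof -
    let ?V = "{x \<in> points X2. g x \<in> U}"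
    have V: "openin (topo X2) ?V"
      using g U(1) unfolding L_morphism_def continuous_map_def by blast
    have uV: "upset X2 ?V"
    proof -
      have "y \<in> ?V" if "x \<in> ?V" "(x, y) \<in> ord X2" for x y
      proof -
        have "(g x, g y) \<in> ord X3" using g that(2) unfolding L_morphism_def by blast
        moreover have "g y \<in> points X3"
          using g ord_in_points[OF KRL_Priestley[OF K2] that(2)] unfolding L_morphism_def continuous_map_def by blast
        ultimately have "g y \<in> U" using that(1) U(2) unfolding upset_def up_def by blast
        then show ?thesis using ord_in_points[OF KRL_Priestley[OF K2] that(2)] by blast
      qed
      then show ?thesis unfolding upset_iff[OF KRL_Priestley[OF K2]] by blast
    qed
    have "{x \<in> points X1. (g \<circ> f) x \<in> topo X3 closure_of U} =
        {x \<in> points X1. f x \<in> {x \<in> points X2. g x \<in> topo X3 closure_of U}}"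
      using L_morphism_points[OF K1 K2 f] by auto
    also have "{x \<in> points X2. g x \<in> topo X3 closure_of U} = topo X2 closure_of ?V"
      using g U unfolding L_morphism_def by blast
    also have "{x \<in> points X1. f x \<in> topo X2 closure_of ?V} = topo X1 closure_of {x \<in> points X1. f x \<in> ?V}"
      using f V uV unfolding L_morphism_def by blast
    also have "{x \<in> points X1. f x \<in> ?V} = {x \<in> points X1. (g \<circ> f) x \<in> U}"
      using L_morphism_points[OF K1 K2 f] by auto
    finally show ?thesis .
  qed
  moreover have "continuous_map (topo X1) (topo X3) (g \<circ> f)"
    using f g continuous_map_compose[of "topo X1" "topo X2" f "topo X3" g] unfolding L_morphism_def by blast
  ultimately show "L_morphism X1 X3 (g \<circ> f)"
    using f g unfolding L_morphism_def by simp
qed (simp add: compose_def)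

lemma is_category_KRLPries: "is_category (KRLPries P)"
  unfolding is_category_def KRLPries_def category.simps
proof (intro conjI ballI)
  fix X assume "X \<in> {X. KRL_space X \<and> P X}"
  then have X: "KRL_space X" by simp
  have "L_morphism X X (\<lambda>x\<in>points X. x)"
    by (rule L_morphism_cong[OF KRL_Priestley[OF X] L_morphism_id]) simp
  then show "(\<lambda>x\<in>points X. x) \<in> {f \<in> extensional (points X). L_morphism X X f}" by simp
  fix Y f assume "Y \<in> {X. KRL_space X \<and> P X}" and "f \<in> {f \<in> extensional (points X). L_morphism X Y f}"
  then have Y: "KRL_space Y" and f: "f \<in> extensional (points X)" "L_morphism X Y f" by auto
  note fp = L_morphism_points[OF X Y f(2)]
  show "compose (points X) f (\<lambda>x\<in>points X. x) = f"
    using f(1) by (auto simp: compose_def fun_eq_iff extensional_def)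
  show "compose (points X) (\<lambda>x\<in>points Y. x) f = f"
    using f(1) fp by (auto simp: compose_def fun_eq_iff extensional_def)
  fix W g assume "W \<in> {X. KRL_space X \<and> P X}" and "g \<in> {f \<in> extensional (points Y). L_morphism Y W f}"
  then have g: "L_morphism Y W g" by auto
  show "compose (points X) g f \<in> {f \<in> extensional (points X). L_morphism X W f}"
    using L_morphism_compose[OF X Y f(2) g] by (simp add: compose_extensional)
  fix h
  show "compose (points X) h (compose (points X) g f) = compose (points X) (compose (points Y) h g) f"
    using fp by (auto simp: compose_def fun_eq_iff)
qed

lemma is_category_KHaus: "is_category (KHaus Q)"
  unfolding is_category_def KHaus_def category.simps
proof (intro conjI ballI)
  fix X assume "X \<in> {Z. compact_space Z \<and> Hausdorff_space Z \<and> Q Z}"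
  have "continuous_map X X (\<lambda>x\<in>topspace X. x)"
    by (rule continuous_map_eq[OF continuous_map_id]) simp
  then show "(\<lambda>x\<in>topspace X. x) \<in> {f \<in> extensional (topspace X). continuous_map X X f}" by simp
  fix Y f assume "f \<in> {f \<in> extensional (topspace X). continuous_map X Y f}"
  then have f: "f \<in> extensional (topspace X)" "continuous_map X Y f" by auto
  have fp: "f x \<in> topspace Y" if "x \<in> topspace X" for x
    using f(2) that unfolding continuous_map_def by blast
  show "compose (topspace X) f (\<lambda>x\<in>topspace X. x) = f"
    using f(1) by (auto simp: compose_def fun_eq_iff extensional_def)
  show "compose (topspace X) (\<lambda>x\<in>topspace Y. x) f = f"
    using f(1) fp by (auto simp: compose_def fun_eq_iff extensional_def)
  fix W g assume "g \<in> {f \<in> extensional (topspace Y). continuous_map Y W f}"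
  then have g: "continuous_map Y W g" by auto
  have "continuous_map X W (compose (topspace X) g f)"
    by (rule continuous_map_eq[OF continuous_map_compose[OF f(2) g]]) (simp add: compose_def)
  then show "compose (topspace X) g f \<in> {f \<in> extensional (topspace X). continuous_map X W f}"
    by (simp add: compose_extensional)
  fix h
  show "compose (topspace X) h (compose (topspace X) g f) = compose (topspace X) (compose (topspace Y) h g) f"
    using fp by (auto simp: compose_def fun_eq_iff)
qed

text \<open>The functor sends \<open>X\<close> to a chosen copy \<open>Fo X\<close> of \<open>Loc X\<close>, with mutually inverse homeomorphisms \<open>k X\<close>
and \<open>l X\<close>, and an L-morphism to its restriction to localic points, conjugated by these.\<close>

theorem KRLPries_equivalent_KHaus:
  fixes P :: "'b ord_space \<Rightarrow> bool" and Q :: "'c topology \<Rightarrow> bool"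
  assumes PQ: "\<And>X. KRL_space X \<Longrightarrow> P X \<Longrightarrow> \<exists>Z. Q Z \<and> Loc X homeomorphic_space Z"
    and QP: "\<And>Z. compact_space Z \<Longrightarrow> Hausdorff_space Z \<Longrightarrow> Q Z \<Longrightarrow>
      \<exists>X. KRL_space X \<and> P X \<and> Loc X homeomorphic_space Z"
  shows "equivalent_categories (KRLPries P) (KHaus Q)"
proof -
  have "\<exists>Z k l. Q Z \<and> homeomorphic_maps (Loc X) Z k l" if "KRL_space X" "P X" for X
    using PQ[OF that] unfolding homeomorphic_space_def by blast
  then have "\<forall>X. \<exists>Z k l. KRL_space X \<and> P X \<longrightarrow> Q Z \<and> homeomorphic_maps (Loc X) Z k l" by blast
  then obtain Fo k l where Q: "\<And>X. KRL_space X \<Longrightarrow> P X \<Longrightarrow> Q (Fo X)"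
    and kl: "\<And>X. KRL_space X \<Longrightarrow> P X \<Longrightarrow> homeomorphic_maps (Loc X) (Fo X) (k X) (l X)"
    by metis
  define Fa where "Fa X1 X2 f = (\<lambda>z\<in>topspace (Fo X1). k X2 (f (l X1 z)))" for X1 X2 f
  have k: "continuous_map (Loc X) (Fo X) (k X)" and l: "continuous_map (Fo X) (Loc X) (l X)"
    and lk: "\<And>y. y \<in> localic_part X \<Longrightarrow> l X (k X y) = y"
    and kl': "\<And>z. z \<in> topspace (Fo X) \<Longrightarrow> k X (l X z) = z"
    and kp: "\<And>y. y \<in> localic_part X \<Longrightarrow> k X y \<in> topspace (Fo X)"
    and lp: "\<And>z. z \<in> topspace (Fo X) \<Longrightarrow> l X z \<in> localic_part X"
    if X: "KRL_space X" "P X" for X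
    using kl[OF X] topspace_Loc[OF KRL_Priestley[OF X(1)]]
    unfolding homeomorphic_maps_def continuous_map_def by auto
  have FoO: "compact_space (Fo X) \<and> Hausdorff_space (Fo X)" if X: "KRL_space X" "P X" for X
  proof -
    have "Loc X homeomorphic_space Fo X" using kl[OF X] unfolding homeomorphic_space_def by blast
    then show ?thesis
      using homeomorphic_compact_space homeomorphic_Hausdorff_space compact_space_Loc[OF X(1)]
        Hausdorff_space_Loc[OF X(1)] by blast
  qed
  have Fa: "Fa X1 X2 f \<in> extensional (topspace (Fo X1)) \<and> continuous_map (Fo X1) (Fo X2) (Fa X1 X2 f)"
    if X1: "KRL_space X1" "P X1" and X2: "KRL_space X2" "P X2" and f: "L_morphism X1 X2 f" for X1 X2 f
  proof -
    have "continuous_map (Fo X1) (Fo X2) (k X2 \<circ> (f \<circ> l X1))"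
      using continuous_map_compose[OF continuous_map_compose[OF l[OF X1]
            L_morphism_continuous_Loc[OF X1(1) X2(1) f]] k[OF X2]] .
    then have "continuous_map (Fo X1) (Fo X2) (Fa X1 X2 f)"
      by (rule continuous_map_eq) (simp add: Fa_def)
    then show ?thesis by (simp add: Fa_def)
  qed
  have Fo_Fa: "is_functor (KRLPries P) (KHaus Q) Fo Fa"
    unfolding is_functor_def KRLPries_def KHaus_def category.simps
  proof (intro conjI ballI)
    fix X1 assume "X1 \<in> {X. KRL_space X \<and> P X}"
    then have X1: "KRL_space X1" "P X1" by auto
    show "Fo X1 \<in> {Z. compact_space Z \<and> Hausdorff_space Z \<and> Q Z}" using FoO[OF X1] Q[OF X1] by simp
    show "Fa X1 X1 (\<lambda>x\<in>points X1. x) = (\<lambda>z\<in>topspace (Fo X1). z)"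
      unfolding Fa_def using lp[OF X1] kl'[OF X1] by (auto simp: fun_eq_iff localic_points)
    fix X2 assume "X2 \<in> {X. KRL_space X \<and> P X}"
    then have X2: "KRL_space X2" "P X2" by auto
    fix f assume "f \<in> {f \<in> extensional (points X1). L_morphism X1 X2 f}"
    then have f: "L_morphism X1 X2 f" by simp
    show "Fa X1 X2 f \<in> {f \<in> extensional (topspace (Fo X1)). continuous_map (Fo X1) (Fo X2) f}"
      using Fa[OF X1 X2 f] by simp
    fix X3 g
    show "Fa X1 X3 (compose (points X1) g f) = compose (topspace (Fo X1)) (Fa X2 X3 g) (Fa X1 X2 f)"
    proof
      fix z
      show "Fa X1 X3 (compose (points X1) g f) z = compose (topspace (Fo X1)) (Fa X2 X3 g) (Fa X1 X2 f) z"
      proof (cases "z \<in> topspace (Fo X1)")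
        case True
        note y = lp[OF X1 True]
        note fy = L_morphism_localic[OF X1(1) X2(1) f y]
        show ?thesis
          using True localic_points[OF y] lk[OF X2 fy] kp[OF X2 fy] by (simp add: Fa_def compose_def)
      qed (simp add: Fa_def compose_def)
    qed
  qed
  have ff: "bij_betw (Fa X1 X2) (Hom (KRLPries P) X1 X2) (Hom (KHaus Q) (Fo X1) (Fo X2))"
    if "X1 \<in> Ob (KRLPries P)" "X2 \<in> Ob (KRLPries P)" for X1 X2
    unfolding bij_betw_def
  proof (intro conjI)
    have X1: "KRL_space X1" "P X1" and X2: "KRL_space X2" "P X2"
      using that by (auto simp: KRLPries_def)
    show "inj_on (Fa X1 X2) (Hom (KRLPries P) X1 X2)"
    proof (rule inj_onI)
      fix f g assume "f \<in> Hom (KRLPries P) X1 X2" "g \<in> Hom (KRLPries P) X1 X2"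
        and eq: "Fa X1 X2 f = Fa X1 X2 g"
      then have f: "f \<in> extensional (points X1)" "L_morphism X1 X2 f"
        and g: "g \<in> extensional (points X1)" "L_morphism X1 X2 g"
        by (auto simp: KRLPries_def)
      have eqY: "f y = g y" if y: "y \<in> localic_part X1" for y
      proof -
        have "k X2 (f y) = k X2 (g y)"
          using fun_cong[OF eq, of "k X1 y"] kp[OF X1 y] lk[OF X1 y] by (simp add: Fa_def)
        then show ?thesis
          using lk[OF X2 L_morphism_localic[OF X1(1) X2(1) f(2) y]]
            lk[OF X2 L_morphism_localic[OF X1(1) X2(1) g(2) y]] by metis
      qed
      show "f = g"
        by (rule extensionalityI[OF f(1) g(1)])
          (rule L_morphism_eq_if_eq_localic[OF X1(1) X2(1) f(2) g(2) eqY])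
    qed
    show "Fa X1 X2 ` Hom (KRLPries P) X1 X2 = Hom (KHaus Q) (Fo X1) (Fo X2)"
    proof
      show "Fa X1 X2 ` Hom (KRLPries P) X1 X2 \<subseteq> Hom (KHaus Q) (Fo X1) (Fo X2)"
        using Fa[OF X1 X2] by (auto simp: KRLPries_def KHaus_def)
      show "Hom (KHaus Q) (Fo X1) (Fo X2) \<subseteq> Fa X1 X2 ` Hom (KRLPries P) X1 X2"
      proof
        fix h assume "h \<in> Hom (KHaus Q) (Fo X1) (Fo X2)"
        then have h: "h \<in> extensional (topspace (Fo X1))" "continuous_map (Fo X1) (Fo X2) h"
          by (auto simp: KHaus_def)
        have "continuous_map (Loc X1) (Loc X2) (l X2 \<circ> (h \<circ> k X1))"
          using continuous_map_compose[OF continuous_map_compose[OF k[OF X1] h(2)] l[OF X2]] .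
        then obtain f where f: "L_morphism X1 X2 f"
          and fh: "\<And>y. y \<in> localic_part X1 \<Longrightarrow> f y = (l X2 \<circ> (h \<circ> k X1)) y"
          by (rule L_morphism_extension[OF X1(1) X2(1)]) blast
        define f' where "f' = restrict f (points X1)"
        have "L_morphism X1 X2 f'"
          by (rule L_morphism_cong[OF KRL_Priestley[OF X1(1)] f]) (simp add: f'_def)
        then have f': "f' \<in> Hom (KRLPries P) X1 X2" by (simp add: KRLPries_def f'_def)
        have "Fa X1 X2 f' = h"
        proof (rule extensionalityI[OF _ h(1)])
          show "Fa X1 X2 f' \<in> extensional (topspace (Fo X1))" by (simp add: Fa_def)
          fix z assume z: "z \<in> topspace (Fo X1)"
          have "h z \<in> topspace (Fo X2)" using h(2) z unfolding continuous_map_def by blast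
          then show "Fa X1 X2 f' z = h z"
            using z localic_points[OF lp[OF X1 z]] fh[OF lp[OF X1 z]] kl'[OF X1 z] kl'[OF X2]
            by (simp add: Fa_def f'_def)
        qed
        then show "h \<in> Fa X1 X2 ` Hom (KRLPries P) X1 X2" using f' by blast
      qed
    qed
  qed
  have es: "\<exists>X\<in>Ob (KRLPries P). \<exists>i. is_iso (KHaus Q) (Fo X) Z i" if "Z \<in> Ob (KHaus Q)" for Z
  proof -
    have Z: "compact_space Z" "Hausdorff_space Z" "Q Z" using that by (auto simp: KHaus_def)
    obtain X where X: "KRL_space X" "P X" "Loc X homeomorphic_space Z" using QP[OF Z] by blast
    have "Fo X homeomorphic_space Loc X"
      using kl[OF X(1,2)] homeomorphic_space_sym unfolding homeomorphic_space_def by blast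
    then have "Fo X homeomorphic_space Z" using X(3) homeomorphic_space_trans by blast
    then obtain i j where ij: "homeomorphic_maps (Fo X) Z i j" unfolding homeomorphic_space_def by blast
    then have i: "continuous_map (Fo X) Z i" and j: "continuous_map Z (Fo X) j"
      and ji: "\<And>x. x \<in> topspace (Fo X) \<Longrightarrow> j (i x) = x" and ij': "\<And>z. z \<in> topspace Z \<Longrightarrow> i (j z) = z"
      unfolding homeomorphic_maps_def by auto
    have ip: "i x \<in> topspace Z" if "x \<in> topspace (Fo X)" for x
      using i that unfolding continuous_map_def by blast
    have jp: "j z \<in> topspace (Fo X)" if "z \<in> topspace Z" for z
      using j that unfolding continuous_map_def by blast
    define i' j' where "i' = restrict i (topspace (Fo X))" and "j' = restrict j (topspace Z)"
    have "i' \<in> Hom (KHaus Q) (Fo X) Z" "j' \<in> Hom (KHaus Q) Z (Fo X)"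
      using continuous_map_eq[OF i, of i'] continuous_map_eq[OF j, of j']
      by (auto simp: KHaus_def i'_def j'_def)
    moreover have "compose (topspace (Fo X)) j' i' = (\<lambda>z\<in>topspace (Fo X). z)"
      "compose (topspace Z) i' j' = (\<lambda>z\<in>topspace Z. z)"
      using ji ij' ip jp by (auto simp: compose_def i'_def j'_def fun_eq_iff)
    ultimately have "is_iso (KHaus Q) (Fo X) Z i'"
      unfolding is_iso_def by (auto simp: KHaus_def)
    moreover have "X \<in> Ob (KRLPries P)" using X by (simp add: KRLPries_def)
    ultimately show ?thesis by blast
  qed
  show ?thesis
    by (rule equivalence_if_fully_faithful_ess_surj[OF is_category_KRLPries is_category_KHaus Fo_Fa ff es])
qed

lemma topology_transfer:
  assumes "inj_on j (topspace T)"
  obtains Z where "T homeomorphic_space Z" "topspace Z = j ` topspace T"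
proof -
  define Z where "Z = pullback_topology (j ` topspace T) (inv_into (topspace T) j) T"
  have top: "topspace Z = j ` topspace T"
    unfolding Z_def topspace_pullback_topology by (auto simp: inv_into_into)
  have "homeomorphic_maps T Z j (inv_into (topspace T) j)"
    unfolding homeomorphic_maps_def
  proof (intro conjI ballI)
    show "continuous_map T Z j"
      unfolding Z_def
    proof (rule continuous_map_pullback')
      show "continuous_map T T (inv_into (topspace T) j \<circ> j)"
        by (rule continuous_map_eq[OF continuous_map_id]) (simp add: assms)
    qed blast
    show "continuous_map Z T (inv_into (topspace T) j)"
      unfolding Z_def using continuous_map_pullback[OF continuous_map_id] by (simp add: comp_def)
  qed (use assms top in \<open>auto simp: f_inv_into_f\<close>)
  then show ?thesis using that[OF _ top] unfolding homeomorphic_space_def by blast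
qed

lemma prime_filters_subset: "prime_filters Z \<subseteq> Pow (Pow (topspace Z))"
  unfolding prime_filters_def using openin_subset by blast

text \<open>For a universe, \<open>Loc X\<close> itself is small, and the prime filters of a small \<open>Z\<close> embed into a
small set because they are elements of an iterated power set. In the second part, the bound
on the localic part is what allows \<open>Loc X\<close> to be moved into \<open>'a\<close>, while the prime filters of \<open>Z\<close>
are already elements of \<open>'a set set\<close>.\<close>

theorem corollary7p12:
  fixes small :: "'u set \<Rightarrow> bool"
  shows "(universe small \<longrightarrow>
            equivalent_categories
              (KRLPries (\<lambda>X :: 'u ord_space. small (points X)))
              (KHaus (\<lambda>Z :: 'u topology. small (topspace Z)))) \<and>
         equivalent_categories
           (KRLPries (\<lambda>X :: 'a set set ord_space. localic_part_within TYPE('a) X))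
           (KHaus (\<lambda>Z :: 'a topology. True))"
proof (intro conjI impI)
  assume u: "universe small"
  have sub: "small B" if "small A" "B \<lesssim> A" for A B
    using u that unfolding universe_def by blast
  have pow: "\<exists>B. small B \<and> Pow A \<lesssim> B" if "small A" for A
    using u that unfolding universe_def by blast
  show "equivalent_categories
      (KRLPries (\<lambda>X :: 'u ord_space. small (points X))) (KHaus (\<lambda>Z :: 'u topology. small (topspace Z)))"
  proof (rule KRLPries_equivalent_KHaus)
    fix X :: "'u ord_space" assume X: "KRL_space X" "small (points X)"
    have "topspace (Loc X) \<lesssim> points X"
      unfolding topspace_Loc[OF KRL_Priestley[OF X(1)]]
      by (rule subset_imp_lepoll) (auto simp: localic_part_def)
    then show "\<exists>Z :: 'u topology. small (topspace Z) \<and> Loc X homeomorphic_space Z"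
      using sub[OF X(2)] homeomorphic_space_refl by blast
  next
    fix Z :: "'u topology" assume Z: "compact_space Z" "Hausdorff_space Z" "small (topspace Z)"
    obtain B where B: "small B" "Pow (topspace Z) \<lesssim> B" using pow[OF Z(3)] by blast
    obtain C where C: "small C" "Pow B \<lesssim> C" using pow[OF B(1)] by blast
    have "Pow (Pow (topspace Z)) \<lesssim> Pow B"
      using B(2) unfolding lepoll_def by (meson inj_on_image_Pow image_Pow_mono)
    then have "prime_filters Z \<lesssim> C"
      using C(2) lepoll_trans subset_imp_lepoll[OF prime_filters_subset] by metis
    then obtain j where j: "inj_on j (prime_filters Z)" "j ` prime_filters Z \<subseteq> C"
      unfolding lepoll_def by blast
    interpret compact_Hausdorff_spectrum Z "j ` prime_filters Z" "inv_into (prime_filters Z) j"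
      using Z(1,2) bij_betw_inv_into[OF inj_on_imp_bij_betw[OF j(1)]] by unfold_locales
    have "small (points X)"
      unfolding points_spectrum using sub[OF C(1) subset_imp_lepoll[OF j(2)]] .
    then show "\<exists>X :: 'u ord_space. KRL_space X \<and> small (points X) \<and> Loc X homeomorphic_space Z"
      using KRL_spectrum Loc_spectrum_homeomorphic by blast
  qed
next
  show "equivalent_categories
      (KRLPries (\<lambda>X :: 'a set set ord_space. localic_part_within TYPE('a) X)) (KHaus (\<lambda>Z :: 'a topology. True))"
  proof (rule KRLPries_equivalent_KHaus)
    fix X :: "'a set set ord_space" assume X: "KRL_space X" "localic_part_within TYPE('a) X"
    obtain j :: "'a set set \<Rightarrow> 'a" where "inj_on j (topspace (Loc X))"
      using X(2) unfolding localic_part_within_def lepoll_def topspace_Loc[OF KRL_Priestley[OF X(1)]] by blast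
    then show "\<exists>Z :: 'a topology. True \<and> Loc X homeomorphic_space Z"
      using topology_transfer by metis
  next
    fix Z :: "'a topology" assume Z: "compact_space Z" "Hausdorff_space Z"
    interpret compact_Hausdorff_spectrum Z "prime_filters Z" "\<lambda>P. P"
      using Z by unfold_locales (auto simp: bij_betw_def)
    obtain f g where "homeomorphic_maps (Loc X) Z f g"
      using Loc_spectrum_homeomorphic unfolding homeomorphic_space_def by blast
    then have "inj_on f (localic_part X)"
      unfolding homeomorphic_maps_def topspace_Loc[OF Priestley_spectrum] by (metis inj_on_inverseI)
    then have "localic_part_within TYPE('a) X"
      unfolding localic_part_within_def lepoll_def by blast
    then show "\<exists>X :: 'a set set ord_space.
        KRL_space X \<and> localic_part_within TYPE('a) X \<and> Loc X homeomorphic_space Z"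
      using KRL_spectrum Loc_spectrum_homeomorphic by blast
  qed
qed

end
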